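(* Let $W$ be a discrete memoryless channel with input alphabet $\mathcal X=\{1,\dots,J\}$ and output alphabet $\mathcal Y=\{1,\dots,K\}$, and let $q:\mathcal X\times\mathcal Y\to\mathbb R$ be a decoding metric. Then $$C_q(W)\le \bar R(W,q):=\max_{P_X}\ \min_{\substack{P_{Y\hat Y|X}\in\mathcal M_{\max}(q,P_X)\\ P_{Y|X}=W}} I(P_X,P_{\hat Y|X}),$$ where the maximum is over probability mass functions $P_X$ on $\mathcal X$, $P_{Y|X}$ and $P_{\hat Y|X}$ denote the two marginal conditional distributions of $P_{Y\hat Y|X}$, and $I(P_X,P_{\hat Y|X})$ is the mutual information between input and output when the input has law $P_X$ and the channel is $P_{\hat Y|X}$.
   Context: A DMC $W$ is a conditional pmf $W(k|j)$ on $\mathcal Y$ given $\mathcal X$, used as $W^n(\mathbf y|\mathbf x)=\prod_{i=1}^n W(y_i|x_i)$. For a codebook $\mathcal C_n=\{\mathbf x_1,\dots,\mathbf x_M\}\subset\mathcal X^n$, a message $m$ is chosen uniformly, $\mathbf x_m$ is sent, and the $q$-decoder outputs $\hat m=\arg\max_{m'} q^n(\mathbf x_{m'},\mathbf y)$ where $q^n(\mathbf x,\mathbf y)=\sum_{i=1}^n q(x_i,y_i)$ (an error occurs whenever some $\bar m\neq m$ has $q^n(\mathbf x_{\bar m},\mathbf y)\ge q^n(\mathbf x_m,\mathbf y)$). $P_e^q(\mathcal C_n,W)$ is the average error probability. A rate $R>0$ is achievable if for every $\epsilon>0$ there is a sequence of codebooks with $|\mathcal C_n|\ge 2^{n(R-\epsilon)}$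 and $\liminf_{n\to\infty} P_e^q(\mathcal C_n,W)=0$; the mismatch capacity $C_q(W)$ is the supremum of achievable rates. For a pmf $P_{X_1}$ on $\mathcal X$, $\mathcal M_{\max}(q,P_{X_1})$ is the set of all conditional pmfs $P_{Y\hat Y|X_1}$ on $\mathcal Y\times\mathcal Y$ given $\mathcal X$ such that, for every conditional pmf $P_{X_2|X_1\hat Y}$ on $\mathcal X$ given $\mathcal X\times\mathcal Y$ for which, under the joint law $P_{X_1}(x_1)P_{Y\hat Y|X_1}(y,\hat y|x_1)P_{X_2|X_1\hat Y}(x_2|x_1,\hat y)$ (so that $X_2-(X_1,\hat Y)-Y$ is a Markov chain), the marginals satisfy $P_{\hat Y X_2}=P_{\hat Y X_1}$, one has $\mathbb E[q(X_2,Y)]\ge \mathbb E[q(X_1,Y)]$. *)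

theory Defs
  imports Complex_Main "HOL-Library.Extended_Real" "HOL-Library.Liminf_Limsup"
begin

(* Input alphabet = finite type 'x, output alphabet = finite type 'y.
   Logarithms are base 2 (rates measured in bits, codebook sizes 2^(nR)). *)

definition is_pmf :: "('a::finite \<Rightarrow> real) \<Rightarrow> bool" where
  "is_pmf P \<longleftrightarrow> (\<forall>a. 0 \<le> P a) \<and> (\<Sum>a\<in>UNIV. P a) = 1"

definition is_channel :: "('a \<Rightarrow> 'b::finite \<Rightarrow> real) \<Rightarrow> bool" where
  "is_channel W \<longleftrightarrow> (\<forall>a. is_pmf (W a))"

definition Wn :: "('x \<Rightarrow> 'y \<Rightarrow> real) \<Rightarrow> nat \<Rightarrow> 'x list \<Rightarrow> 'y list \<Rightarrow> real" where
  "Wn W n xs ys = (\<Prod>i<n. W (xs ! i) (ys ! i))"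

definition qn :: "('x \<Rightarrow> 'y \<Rightarrow> real) \<Rightarrow> nat \<Rightarrow> 'x list \<Rightarrow> 'y list \<Rightarrow> real" where
  "qn q n xs ys = (\<Sum>i<n. q (xs ! i) (ys ! i))"

(* a codebook of block length n: nonempty list of distinct codewords in X^n;
   message m is sent as codeword C ! m, |C_n| = length C *)
definition is_codebook :: "nat \<Rightarrow> 'x list list \<Rightarrow> bool" where
  "is_codebook n C \<longleftrightarrow> C \<noteq> [] \<and> distinct C \<and> (\<forall>c\<in>set C. length c = n)"

(* average error probability of the q-decoder (ties count as errors) *)
definition Pe :: "('x \<Rightarrow> 'y::finite \<Rightarrow> real) \<Rightarrow> ('x \<Rightarrow> 'y \<Rightarrow> real) \<Rightarrow> nat \<Rightarrow> 'x list list \<Rightarrow> real" where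
  "Pe q W n C = (1 / real (length C)) *
     (\<Sum>m<length C. \<Sum>ys\<in>{ys :: 'y list. length ys = n}.
        (if (\<exists>m'<length C. m' \<noteq> m \<and> qn q n (C ! m') ys \<ge> qn q n (C ! m) ys)
         then Wn W n (C ! m) ys else 0))"

definition achievable :: "('x \<Rightarrow> 'y::finite \<Rightarrow> real) \<Rightarrow> ('x \<Rightarrow> 'y \<Rightarrow> real) \<Rightarrow> real \<Rightarrow> bool" where
  "achievable q W R \<longleftrightarrow> R > 0 \<and>
     (\<forall>\<epsilon>>0. \<exists>Cs :: nat \<Rightarrow> 'x list list.
        (\<forall>n. is_codebook n (Cs n) \<and> real (length (Cs n)) \<ge> 2 powr (real n * (R - \<epsilon>)))
        \<and> liminf (\<lambda>n. ereal (Pe q W n (Cs n))) = 0)"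

definition mismatch_capacity :: "('x \<Rightarrow> 'y::finite \<Rightarrow> real) \<Rightarrow> ('x \<Rightarrow> 'y \<Rightarrow> real) \<Rightarrow> ereal" where
  "mismatch_capacity q W = Sup (ereal ` {R. achievable q W R})"

definition mutual_info :: "('x::finite \<Rightarrow> real) \<Rightarrow> ('x \<Rightarrow> 'y::finite \<Rightarrow> real) \<Rightarrow> real" where
  "mutual_info P V = (\<Sum>x\<in>UNIV. \<Sum>y\<in>UNIV.
      (if P x * V x y = 0 then 0
       else P x * V x y * log 2 (V x y / (\<Sum>x'\<in>UNIV. P x' * V x' y))))"

definition is_cond_pmf2 :: "('x \<Rightarrow> 'y::finite \<Rightarrow> 'y \<Rightarrow> real) \<Rightarrow> bool" where
  "is_cond_pmf2 V \<longleftrightarrow> (\<forall>x y yh. 0 \<le> V x y yh) \<and> (\<forall>x. (\<Sum>y\<in>UNIV. \<Sum>yh\<in>UNIV. V x y yh) = 1)"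

(* M_max(q, P): U x1 yh x2 is P_{X2|X1 Yhat} *)
definition Mmax :: "('x::finite \<Rightarrow> 'y::finite \<Rightarrow> real) \<Rightarrow> ('x \<Rightarrow> real) \<Rightarrow> ('x \<Rightarrow> 'y \<Rightarrow> 'y \<Rightarrow> real) set" where
  "Mmax q P = {V. is_cond_pmf2 V \<and>
     (\<forall>U :: 'x \<Rightarrow> 'y \<Rightarrow> 'x \<Rightarrow> real.
        ((\<forall>x1 yh. is_pmf (U x1 yh)) \<and>
         (\<forall>yh x2. (\<Sum>x1\<in>UNIV. \<Sum>y\<in>UNIV. P x1 * V x1 y yh * U x1 yh x2)
                  = (\<Sum>y\<in>UNIV. P x2 * V x2 y yh)))
        \<longrightarrow> (\<Sum>x1\<in>UNIV. \<Sum>y\<in>UNIV. \<Sum>yh\<in>UNIV. \<Sum>x2\<in>UNIV.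
               P x1 * V x1 y yh * U x1 yh x2 * q x2 y)
            \<ge> (\<Sum>x1\<in>UNIV. \<Sum>y\<in>UNIV. \<Sum>yh\<in>UNIV. P x1 * V x1 y yh * q x1 y))}"

definition marg_Y :: "('x \<Rightarrow> 'y::finite \<Rightarrow> 'y \<Rightarrow> real) \<Rightarrow> 'x \<Rightarrow> 'y \<Rightarrow> real" where
  "marg_Y V x y = (\<Sum>yh\<in>UNIV. V x y yh)"

definition marg_Yhat :: "('x \<Rightarrow> 'y::finite \<Rightarrow> 'y \<Rightarrow> real) \<Rightarrow> 'x \<Rightarrow> 'y \<Rightarrow> real" where
  "marg_Yhat V x yh = (\<Sum>y\<in>UNIV. V x y yh)"

definition Rbar :: "('x::finite \<Rightarrow> 'y::finite \<Rightarrow> real) \<Rightarrow> ('x \<Rightarrow> 'y \<Rightarrow> real) \<Rightarrow> real" where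
  "Rbar W q = (SUP P\<in>{P. is_pmf P}.
      INF V\<in>{V. V \<in> Mmax q P \<and> marg_Y V = W}. mutual_info P (marg_Yhat V))"

end

theory Submission
  imports Defs "HOL-Library.Multiset" "HOL-Library.Cardinality" "HOL-Library.FuncSet"
begin

text \<open>
  Let \<open>V\<close> be maximal for a fully supported \<open>P\<close>, with \<open>Y\<close>-marginal \<open>W\<close>, and draw \<open>(Y, Z)\<close> from the
  memoryless extension of \<open>V\<close> when \<open>x\<close> is sent, where \<open>Z\<close> stands for the auxiliary output.

  If another codeword \<open>x'\<close> has the same joint type with \<open>Z\<close> as \<open>x\<close>, then the empirical law of
  \<open>(x, Z, x')\<close> is, for each letter of \<open>Z\<close>, a circulation on the input alphabet. Hence maximality makes
  the conditional mean of \<open>q(x', Y) - q(x, Y)\<close> given \<open>Z\<close> nonnegative, with no loss from the deviation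
  of the type from \<open>P\<close> and \<open>V\<close>. A sum of independent variables taken from finitely many laws
  and with nonnegative mean is nonnegative with probability bounded away from zero (fourth moments),
  so the decoder errs with at least this probability.

  For each \<open>Z\<close> at most polynomially many codewords share their joint type with no other
  codeword. Changing measure to the product output law shows that such an isolated codeword is rarely
  the one sent once the rate exceeds the mutual information between input and \<open>Z\<close>.

  The law \<open>P\<close> is taken from a finite family that dominates the composition of every codeword up to
  a factor \<open>1 + \<eta>\<close>, which makes all constants uniform over the code.
\<close>

section \<open>Expectations under memoryless channels\<close>

text \<open>The letters in \<open>as\<close> may later be pairs or triples, and \<open>K\<close> has
  to be a pmf only at letters that occur; both freedoms serve kernels conditioned on
  \<open>Z\<close>.\<close>

definition block_expect :: "('a \<Rightarrow> 'y::finite \<Rightarrow> real) \<Rightarrow> 'a list \<Rightarrow> ('y list \<Rightarrow> real) \<Rightarrow> real" where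
  "block_expect K as F =
     (\<Sum>ys | length ys = length as. (\<Prod>i<length as. K (as ! i) (ys ! i)) * F ys)"

lemma finite_lists_length [simp]: "finite {ys :: 'y::finite list. length ys = n}"
  using finite_lists_length_eq[of "UNIV :: 'y set" n] by simp

lemma sum_lists_length_Suc:
  fixes f :: "'y::finite list \<Rightarrow> real"
  shows "(\<Sum>ys | length ys = Suc n. f ys) = (\<Sum>y\<in>UNIV. \<Sum>ys | length ys = n. f (y # ys))"
proof -
  have "(\<Sum>ys | length ys = Suc n. f ys)
      = (\<Sum>p\<in>UNIV \<times> {ys. length ys = n}. f (fst p # snd p))"
    by (rule sum.reindex_bij_witness[where i = "\<lambda>p. fst p # snd p" and j = "\<lambda>ys. (hd ys, tl ys)"])
      (auto simp: length_Suc_conv)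
  also have "\<dots> = (\<Sum>y\<in>UNIV. \<Sum>ys | length ys = n. f (y # ys))"
    by (simp add: sum.cartesian_product case_prod_beta)
  finally show ?thesis .
qed

lemma block_expect_Nil [simp]: "block_expect K [] F = F []"
  by (simp add: block_expect_def)

lemma block_expect_Cons:
  "block_expect K (a # as) F = (\<Sum>y\<in>UNIV. K a y * block_expect K as (\<lambda>ys. F (y # ys)))"
  unfolding block_expect_def
  by (simp add: sum_lists_length_Suc prod.lessThan_Suc_shift sum_distrib_left mult.assoc
      del: prod.lessThan_Suc)

lemma block_expect_add:
  "block_expect K as (\<lambda>ys. F ys + G ys) = block_expect K as F + block_expect K as G"
  by (simp add: block_expect_def algebra_simps sum.distrib)

lemma block_expect_diff:
  "block_expect K as (\<lambda>ys. F ys - G ys) = block_expect K as F - block_expect K as G"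
  by (simp add: block_expect_def algebra_simps sum_subtractf)

lemma block_expect_cmult: "block_expect K as (\<lambda>ys. c * F ys) = c * block_expect K as F"
  by (simp add: block_expect_def sum_distrib_left mult_ac)

lemma block_expect_sum:
  "block_expect K as (\<lambda>ys. \<Sum>j\<in>A. F j ys) = (\<Sum>j\<in>A. block_expect K as (F j))"
  unfolding block_expect_def sum_distrib_left by (rule sum.swap)

lemma block_expect_const:
  assumes "\<And>a. a \<in> set as \<Longrightarrow> is_pmf (K a)"
  shows "block_expect K as (\<lambda>ys. c) = c"
  using assms
proof (induction as)
  case (Cons a as)
  then have "(\<Sum>y\<in>UNIV. K a y) = 1" by (simp add: is_pmf_def)
  with Cons show ?case
    by (simp add: block_expect_Cons sum_distrib_right[symmetric])
qed simp

lemma block_weight_nonneg: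
  assumes "\<And>a. a \<in> set as \<Longrightarrow> is_pmf (K a)"
  shows "0 \<le> (\<Prod>i<length as. K (as ! i) (ys ! i))"
  using assms by (intro prod_nonneg) (auto simp: is_pmf_def)

text \<open>Outputs of weight zero are exempt from the comparison, so that later \<open>zs\<close>
  may be assumed to lie in the support of the auxiliary channel.\<close>

lemma block_expect_mono:
  assumes "\<And>a. a \<in> set as \<Longrightarrow> is_pmf (K a)"
    and "\<And>ys. length ys = length as \<Longrightarrow> (\<Prod>i<length as. K (as ! i) (ys ! i)) \<noteq> 0 \<Longrightarrow> F ys \<le> G ys"
  shows "block_expect K as F \<le> block_expect K as G"
  unfolding block_expect_def
proof (rule sum_mono)
  fix ys :: "'b list" assume ys: "ys \<in> {ys. length ys = length as}"
  define p where "p = (\<Prod>i<length as. K (as ! i) (ys ! i))"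
  have "0 \<le> p" unfolding p_def by (rule block_weight_nonneg[OF assms(1)])
  moreover have "p \<noteq> 0 \<Longrightarrow> F ys \<le> G ys" using assms(2)[of ys] ys by (simp add: p_def)
  ultimately show "p * F ys \<le> p * G ys"
    by (cases "p = 0") (auto intro: mult_left_mono)
qed

text \<open>The two letter types may differ. This permits forgetting the third component of a
  triple, or exchanging codewords when the kernel ignores its input.\<close>

lemma block_expect_cong:
  assumes "length as = length bs"
    and "\<And>i y. i < length as \<Longrightarrow> K (as ! i) y = L (bs ! i) y"
    and "\<And>ys. length ys = length as \<Longrightarrow> F ys = G ys"
  shows "block_expect K as F = block_expect L bs G"
  unfolding block_expect_def using assms by (intro sum.cong) auto

section \<open>Sums of independent variables: moments and the probability of being
  nonnegative\<close>

definition block_sum :: "('a \<Rightarrow> 'y \<Rightarrow> real) \<Rightarrow> 'a list \<Rightarrow> 'y list \<Rightarrow> real" where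
  "block_sum g as ys = (\<Sum>i<length as. g (as ! i) (ys ! i))"

lemma block_sum_Nil [simp]: "block_sum g [] ys = 0"
  by (simp add: block_sum_def)

lemma block_sum_Cons [simp]: "block_sum g (a # as) (y # ys) = g a y + block_sum g as ys"
  by (simp add: block_sum_def sum.lessThan_Suc_shift del: sum.lessThan_Suc)

text \<open>Induction adds one independent letter: in the expanded powers of
  \<open>g a y + S\<close> every term linear in \<open>g a y\<close> or in \<open>S\<close> has mean
  zero. In the fourth moment, \<open>3 * s\<^sup>2\<close> absorbs the pairs of distinct letters and
  \<open>B * s\<close> the fourth powers of single letters.\<close>

lemma centred_moments:
  fixes K :: "'a \<Rightarrow> 'y::finite \<Rightarrow> real"
  assumes "\<And>a. a \<in> set as \<Longrightarrow> is_pmf (K a)"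
    and "\<And>a. a \<in> set as \<Longrightarrow> (\<Sum>y\<in>UNIV. K a y * g a y) = 0"
    and "\<And>a y. a \<in> set as \<Longrightarrow> (g a y)\<^sup>2 \<le> B"
  defines "s \<equiv> \<Sum>a\<leftarrow>as. \<Sum>y\<in>UNIV. K a y * (g a y)\<^sup>2"
  shows "block_expect K as (block_sum g as) = 0"
    and "block_expect K as (\<lambda>ys. (block_sum g as ys)\<^sup>2) = s"
    and "block_expect K as (\<lambda>ys. block_sum g as ys ^ 4) \<le> 3 * s\<^sup>2 + B * s"
proof -
  have "block_expect K as (block_sum g as) = 0
    \<and> block_expect K as (\<lambda>ys. (block_sum g as ys)\<^sup>2) = s
    \<and> block_expect K as (\<lambda>ys. block_sum g as ys ^ 4) \<le> 3 * s\<^sup>2 + B * s"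
    unfolding s_def using assms(1-3)
  proof (induction as)
    case (Cons a as)
    define v where "v = (\<Sum>y\<in>UNIV. K a y * (g a y)\<^sup>2)"
    define s where "s = (\<Sum>a\<leftarrow>as. \<Sum>y\<in>UNIV. K a y * (g a y)\<^sup>2)"
    let ?E = "block_expect K as" and ?S = "block_sum g as"
    have pmf: "\<And>a. a \<in> set as \<Longrightarrow> is_pmf (K a)" using Cons.prems by simp
    have IH: "?E ?S = 0" "?E (\<lambda>ys. (?S ys)\<^sup>2) = s" "?E (\<lambda>ys. ?S ys ^ 4) \<le> 3 * s\<^sup>2 + B * s"
      using Cons by (auto simp: s_def)
    have K1: "(\<Sum>y\<in>UNIV. K a y) = 1" and K0: "\<And>y. 0 \<le> K a y"
      using Cons.prems(1)[of a] by (auto simp: is_pmf_def)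
    have g0: "(\<Sum>y\<in>UNIV. K a y * g a y) = 0" using Cons.prems(2) by simp
    have E1: "?E (\<lambda>ys. g a y + ?S ys) = g a y" for y
      using IH(1) by (simp add: block_expect_add block_expect_const[OF pmf])
    have E2: "?E (\<lambda>ys. (g a y + ?S ys)\<^sup>2) = (g a y)\<^sup>2 + s" for y
    proof -
      have "?E (\<lambda>ys. (g a y + ?S ys)\<^sup>2) = ?E (\<lambda>ys. (g a y)\<^sup>2 + ((2 * g a y) * ?S ys + (?S ys)\<^sup>2))"
        by (simp add: power2_sum algebra_simps)
      then show ?thesis
        using IH by (simp add: block_expect_add block_expect_cmult block_expect_const[OF pmf])
    qed
    \<comment> \<open>The third moment is never evaluated: its coefficient \<open>4 * g a y\<close>
      averages to zero over \<open>y\<close>.\<close>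
    define e3 where "e3 = ?E (\<lambda>ys. ?S ys ^ 3)"
    define e4 where "e4 = ?E (\<lambda>ys. ?S ys ^ 4)"
    have E4: "?E (\<lambda>ys. (g a y + ?S ys) ^ 4) = g a y ^ 4 + 6 * (g a y)\<^sup>2 * s + 4 * e3 * g a y + e4" for y
    proof -
      have "?E (\<lambda>ys. (g a y + ?S ys) ^ 4) = ?E (\<lambda>ys. g a y ^ 4 + ((4 * g a y ^ 3) * ?S ys
          + ((6 * (g a y)\<^sup>2) * (?S ys)\<^sup>2 + ((4 * g a y) * ?S ys ^ 3 + ?S ys ^ 4))))"
        by (rule arg_cong[where f = ?E]) (rule ext, algebra)
      then show ?thesis
        using IH by (simp add: block_expect_add block_expect_cmult block_expect_const[OF pmf]
            e3_def e4_def)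
    qed
    have 1: "block_expect K (a # as) (block_sum g (a # as)) = 0"
      by (simp add: block_expect_Cons E1 g0)
    have 2: "block_expect K (a # as) (\<lambda>ys. (block_sum g (a # as) ys)\<^sup>2) = v + s"
      by (simp add: block_expect_Cons E2 distrib_left sum.distrib v_def sum_distrib_right[symmetric] K1)
    have "block_expect K (a # as) (\<lambda>ys. block_sum g (a # as) ys ^ 4)
       = (\<Sum>y\<in>UNIV. K a y * g a y ^ 4 + 6 * s * (K a y * (g a y)\<^sup>2) + 4 * e3 * (K a y * g a y) + K a y * e4)"
      by (simp add: block_expect_Cons E4 algebra_simps)
    also have "\<dots> = (\<Sum>y\<in>UNIV. K a y * g a y ^ 4) + 6 * s * v + e4"
      by (simp add: sum.distrib sum_distrib_left[symmetric] sum_distrib_right[symmetric] K1 g0 v_def)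
    also have "(\<Sum>y\<in>UNIV. K a y * g a y ^ 4) \<le> B * v"
      unfolding v_def sum_distrib_left
    proof (rule sum_mono)
      fix y
      have "(g a y)\<^sup>2 * (K a y * (g a y)\<^sup>2) \<le> B * (K a y * (g a y)\<^sup>2)"
        using Cons.prems(3)[of a y] K0[of y] by (intro mult_right_mono) auto
      then show "K a y * g a y ^ 4 \<le> B * (K a y * (g a y)\<^sup>2)"
        by (simp add: power4_eq_xxxx power2_eq_square mult_ac)
    qed
    also have "B * v + 6 * s * v + e4 \<le> 3 * (v + s)\<^sup>2 + B * (v + s)"
    proof -
      have "3 * (v + s)\<^sup>2 = 3 * v\<^sup>2 + 6 * s * v + 3 * s\<^sup>2" by (simp add: power2_sum)
      then show ?thesis using IH(3) zero_le_power2[of v] unfolding e4_def[symmetric] distrib_left by linarith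
    qed
    finally show ?case using 1 2 by (simp add: v_def s_def)
  qed simp
  then show "block_expect K as (block_sum g as) = 0"
    and "block_expect K as (\<lambda>ys. (block_sum g as ys)\<^sup>2) = s"
    and "block_expect K as (\<lambda>ys. block_sum g as ys ^ 4) \<le> 3 * s\<^sup>2 + B * s"
    by auto
qed

text \<open>For \<open>E t = 0\<close>, \<open>E t\<^sup>2 = 1\<close> and \<open>E t\<^sup>4 \<le> C\<close>, taking expectations bounds the probability of \<open>t \<ge> 0\<close>
  from below by \<open>1 / (12 C\<^sup>2)\<close>.\<close>

lemma nonneg_indicator_quartic_bound:
  fixes t C :: real
  assumes "2 \<le> C"
  shows "(C * t + t\<^sup>2 - t ^ 4 / (2 * C)) / (6 * C\<^sup>2) \<le> (if 0 \<le> t then 1 else 0)"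
proof (cases "0 \<le> t")
  case True
  \<comment> \<open>Up to \<open>2 * C\<close> the first two terms are at most
    \<open>2 * C\<^sup>2\<close> and \<open>4 * C\<^sup>2\<close>, which explains the factor 6;
    beyond that point the quartic term outweighs both.\<close>
  have "C * t + t\<^sup>2 - t ^ 4 / (2 * C) \<le> 6 * C\<^sup>2"
  proof (cases "t \<le> 2 * C")
    case t: True
    have "C * t \<le> C * (2 * C)" using t assms by (intro mult_left_mono) auto
    moreover have "t\<^sup>2 \<le> (2 * C)\<^sup>2" using t True by (intro power_mono) auto
    moreover have "0 \<le> t ^ 4 / (2 * C)" using assms by simp
    ultimately show ?thesis by (simp add: power2_eq_square)
  next
    case False
    then have t: "2 * C < t" by simp
    have "C * t + t\<^sup>2 \<le> t * t + t\<^sup>2" using t assms True by (intro add_mono mult_right_mono) auto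
    also have "\<dots> = 2 * t\<^sup>2" by (simp add: power2_eq_square)
    also have "\<dots> \<le> t ^ 4 / (2 * C)"
    proof -
      have "4 * C \<le> t * t"
        using t assms True mult_mono[of 4 t C t] by auto
      then have "4 * C * t\<^sup>2 \<le> t * t * t\<^sup>2" by (intro mult_right_mono) auto
      then show ?thesis using assms by (simp add: field_simps power4_eq_xxxx power2_eq_square)
    qed
    finally show ?thesis using zero_le_power2[of C] by linarith
  qed
  then show ?thesis using True assms by (simp add: divide_le_eq)
next
  case False
  define u where "u = - t"
  have u: "0 < u" using False by (simp add: u_def)
  \<comment> \<open>The square is absorbed by the linear term while \<open>u \<le> C\<close> and by
    the quartic term afterwards, where \<open>2 \<le> C\<close> yields
    \<open>2 * C \<le> u * u\<close>.\<close>
  have "u * u - u ^ 4 / (2 * C) \<le> C * u"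
  proof (cases "u \<le> C")
    case True
    have "u * u \<le> C * u" using True u by (intro mult_right_mono) auto
    then show ?thesis using assms by (smt (verit) divide_nonneg_pos zero_le_even_power even_numeral)
  next
    case C: False
    have "2 * C \<le> u * u" using C assms u by (intro mult_mono) auto
    then have "2 * C * (u * u) \<le> u * u * (u * u)" by (intro mult_right_mono) auto
    then have "u * u \<le> u ^ 4 / (2 * C)" using assms by (simp add: field_simps power4_eq_xxxx)
    then show ?thesis using u assms by (smt (verit) mult_nonneg_nonneg)
  qed
  then have "C * t + t\<^sup>2 - t ^ 4 / (2 * C) \<le> 0" by (simp add: u_def power2_eq_square)
  then show ?thesis using False by (simp add: divide_nonpos_nonneg)
qed

text \<open>After division by the standard deviation \<open>sqrt s\<close> the fourth moment is at
  most \<open>3 + B / \<sigma>\<close>: a single nondegenerate letter forces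
  \<open>\<sigma> \<le> s\<close>, hence \<open>B * s \<le> (B / \<sigma>) * s\<^sup>2\<close>. The
  quartic minorant then gives a bound free of the block length.\<close>

lemma centred_sum_nonneg_prob:
  fixes K :: "'a \<Rightarrow> 'y::finite \<Rightarrow> real"
  assumes pmf: "\<And>a. a \<in> set as \<Longrightarrow> is_pmf (K a)"
    and mean: "\<And>a. a \<in> set as \<Longrightarrow> (\<Sum>y\<in>UNIV. K a y * g a y) = 0"
    and B: "\<And>a y. a \<in> set as \<Longrightarrow> (g a y)\<^sup>2 \<le> B"
    and var: "\<And>a. a \<in> set as \<Longrightarrow> (\<Sum>y\<in>UNIV. K a y * (g a y)\<^sup>2) \<noteq> 0 \<Longrightarrow>
                 \<sigma> \<le> (\<Sum>y\<in>UNIV. K a y * (g a y)\<^sup>2)"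
    and "0 < \<sigma>" and "0 \<le> B"
  shows "1 / (12 * (3 + B / \<sigma>)\<^sup>2) \<le>
           block_expect K as (\<lambda>ys. if 0 \<le> block_sum g as ys then 1 else 0)"
proof -
  define v where "v = (\<lambda>a. \<Sum>y\<in>UNIV. K a y * (g a y)\<^sup>2)"
  define s where "s = (\<Sum>a\<leftarrow>as. v a)"
  define C where "C = 3 + B / \<sigma>"
  let ?E = "block_expect K as" and ?S = "block_sum g as"
  have C: "3 \<le> C" using assms(5,6) by (simp add: C_def)
  have mom: "?E ?S = 0" "?E (\<lambda>ys. (?S ys)\<^sup>2) = s" "?E (\<lambda>ys. ?S ys ^ 4) \<le> 3 * s\<^sup>2 + B * s"
    using centred_moments[of as K g B] pmf mean B by (auto simp: s_def v_def)
  have v0: "0 \<le> v a" if "a \<in> set as" for a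
    using pmf[OF that] unfolding v_def by (intro sum_nonneg) (auto simp: is_pmf_def)
  have "1 / (12 * C\<^sup>2) \<le> ?E (\<lambda>ys. if 0 \<le> ?S ys then 1 else 0)"
  proof (cases "\<forall>a\<in>set as. v a = 0")
    case True
    \<comment> \<open>Without any variance the sum vanishes on every output of positive weight, so
      the event is certain.\<close>
    then have "s = 0" unfolding s_def by (simp cong: map_cong)
    then have "?E (\<lambda>ys. (?S ys)\<^sup>2) = 0" using mom(2) by simp
    then have zero: "(\<Prod>i<length as. K (as ! i) (ys ! i)) * (?S ys)\<^sup>2 = 0" if "length ys = length as" for ys
      unfolding block_expect_def using that
      by (subst (asm) sum_nonneg_eq_0_iff)
        (auto intro!: mult_nonneg_nonneg block_weight_nonneg pmf)
    have "1 = ?E (\<lambda>ys. 1)" by (simp add: block_expect_const pmf)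
    also have "\<dots> \<le> ?E (\<lambda>ys. if 0 \<le> ?S ys then 1 else 0)"
      using zero by (intro block_expect_mono pmf) force+
    finally have "1 \<le> ?E (\<lambda>ys. if 0 \<le> ?S ys then 1 else 0)" .
    moreover have "1 / (12 * C\<^sup>2) \<le> 1"
      using C one_le_power[of C 2] by (simp add: divide_le_eq_1 del: one_le_power)
    ultimately show ?thesis by linarith
  next
    case False
    then obtain a where a: "a \<in> set as" "v a \<noteq> 0" by auto
    have "\<sigma> \<le> v a" using var[OF a(1)] a(2) by (simp add: v_def)
    also have "v a \<le> s" unfolding s_def
      using a(1) v0 by (intro member_le_sum_list) auto
    finally have s: "\<sigma> \<le> s" .
    then have s0: "0 < s" using assms(5) by simp
    have "B * s \<le> (B / \<sigma>) * s\<^sup>2"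
    proof -
      have "B * s * \<sigma> \<le> B * s * s" using s s0 assms(6) by (intro mult_left_mono) auto
      then show ?thesis using assms(5) by (simp add: field_simps power2_eq_square)
    qed
    then have m4: "?E (\<lambda>ys. ?S ys ^ 4) \<le> C * s\<^sup>2"
      using mom(3) by (simp add: C_def algebra_simps)
    define r where "r = sqrt s"
    have r: "0 < r" "r\<^sup>2 = s" "r ^ 4 = s\<^sup>2"
      using s0 by (auto simp: r_def power2_eq_square power4_eq_xxxx)
    have "1 / (12 * C\<^sup>2) = (1 - C / (2 * C)) / (6 * C\<^sup>2)" using C by (simp add: field_simps)
    also have "\<dots> \<le> (1 - ?E (\<lambda>ys. ?S ys ^ 4) / (s\<^sup>2 * (2 * C))) / (6 * C\<^sup>2)"
    proof -
      have "?E (\<lambda>ys. ?S ys ^ 4) / (s\<^sup>2 * (2 * C)) \<le> C * s\<^sup>2 / (s\<^sup>2 * (2 * C))"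
        using m4 C s0 by (intro divide_right_mono) auto
      also have "\<dots> = C / (2 * C)" using s0 C by simp
      finally show ?thesis by (intro divide_right_mono) auto
    qed
    also have "\<dots> = ?E (\<lambda>ys. (1 / (6 * C * r)) * ?S ys
        + ((1 / (6 * C\<^sup>2 * s)) * (?S ys)\<^sup>2 - (1 / (6 * C\<^sup>2 * (s\<^sup>2 * (2 * C)))) * ?S ys ^ 4))"
      unfolding block_expect_add block_expect_diff block_expect_cmult mom(1,2)
      using s0 C r by (simp add: field_simps)
    also have "\<dots> = ?E (\<lambda>ys. (C * (?S ys / r) + (?S ys / r)\<^sup>2 - (?S ys / r) ^ 4 / (2 * C)) / (6 * C\<^sup>2))"
      using C r s0 by (intro block_expect_cong refl)
        (simp add: power_divide add_divide_distrib diff_divide_distrib power2_eq_square mult_ac)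
    also have "\<dots> \<le> ?E (\<lambda>ys. if 0 \<le> ?S ys then 1 else 0)"
    proof (intro block_expect_mono pmf)
      fix ys :: "'y list"
      show "(C * (?S ys / r) + (?S ys / r)\<^sup>2 - (?S ys / r) ^ 4 / (2 * C)) / (6 * C\<^sup>2)
          \<le> (if 0 \<le> ?S ys then 1 else 0)"
        using nonneg_indicator_quartic_bound[of C "?S ys / r"] C r(1) by (simp add: zero_le_divide_iff)
    qed
    finally show ?thesis .
  qed
  then show ?thesis by (simp add: C_def)
qed

text \<open>Individual means may be negative. Centring every letter subtracts the total mean, which
  is nonnegative, and so can only shrink the event. As there are finitely many letters,
  \<open>B\<close> and \<open>\<sigma>\<close> can be chosen globally, whence \<open>c\<close> is
  uniform over blocks.\<close>

lemma nonneg_mean_sum_prob: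
  fixes K :: "'a::finite \<Rightarrow> 'y::finite \<Rightarrow> real"
  shows "\<exists>c>0. \<forall>as. (\<forall>a\<in>set as. is_pmf (K a)) \<longrightarrow>
           0 \<le> (\<Sum>a\<leftarrow>as. \<Sum>y\<in>UNIV. K a y * g a y) \<longrightarrow>
           c \<le> block_expect K as (\<lambda>ys. if 0 \<le> block_sum g as ys then 1 else 0)"
proof -
  define \<mu> where "\<mu> = (\<lambda>a. \<Sum>y\<in>UNIV. K a y * g a y)"
  define h where "h = (\<lambda>a y. g a y - \<mu> a)"
  define B where "B = (\<Sum>a\<in>UNIV. \<Sum>y\<in>UNIV. (h a y)\<^sup>2)"
  define v where "v = (\<lambda>a. \<Sum>y\<in>UNIV. K a y * (h a y)\<^sup>2)"
  \<comment> \<open>Only positive variances enter, so the minimum is positive;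
    \<open>insert 1\<close> covers the case in which there are none.\<close>
  define \<sigma> where "\<sigma> = Min (insert 1 ({v a | a. v a > 0}))"
  have B: "(h a y)\<^sup>2 \<le> B" for a y
  proof -
    have "(h a y)\<^sup>2 \<le> (\<Sum>y\<in>UNIV. (h a y)\<^sup>2)" by (intro member_le_sum) auto
    also have "\<dots> \<le> B" unfolding B_def
      by (rule member_le_sum[of a UNIV "\<lambda>a. \<Sum>y\<in>UNIV. (h a y)\<^sup>2"]) (auto intro: sum_nonneg)
    finally show ?thesis .
  qed
  have B0: "0 \<le> B" unfolding B_def by (intro sum_nonneg) auto
  have fin: "finite {v a | a. v a > 0}" by simp
  have \<sigma>0: "0 < \<sigma>" unfolding \<sigma>_def using fin by (subst Min_gr_iff) auto
  show ?thesis
  proof (intro exI[of _ "1 / (12 * (3 + B / \<sigma>)\<^sup>2)"] conjI allI impI)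
    have "0 < 3 + B / \<sigma>" using B0 \<sigma>0 by (simp add: add_pos_nonneg)
    then show "0 < 1 / (12 * (3 + B / \<sigma>)\<^sup>2)" by simp
    fix as assume pmf: "\<forall>a\<in>set as. is_pmf (K a)"
      and mean: "0 \<le> (\<Sum>a\<leftarrow>as. \<Sum>y\<in>UNIV. K a y * g a y)"
    have "1 / (12 * (3 + B / \<sigma>)\<^sup>2) \<le> block_expect K as (\<lambda>ys. if 0 \<le> block_sum h as ys then 1 else 0)"
    proof (rule centred_sum_nonneg_prob)
      fix a assume "a \<in> set as"
      then have p: "(\<Sum>y\<in>UNIV. K a y) = 1" "\<And>y. 0 \<le> K a y" using pmf by (auto simp: is_pmf_def)
      show "(\<Sum>y\<in>UNIV. K a y * h a y) = 0"
        by (simp add: h_def right_diff_distrib sum_subtractf sum_distrib_right[symmetric] p \<mu>_def)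
      have "0 \<le> v a" unfolding v_def using p by (intro sum_nonneg) auto
      moreover assume "(\<Sum>y\<in>UNIV. K a y * (h a y)\<^sup>2) \<noteq> 0"
      ultimately have "0 < v a" by (simp add: v_def)
      then have "\<sigma> \<le> v a" unfolding \<sigma>_def using fin by (intro Min_le) auto
      then show "\<sigma> \<le> (\<Sum>y\<in>UNIV. K a y * (h a y)\<^sup>2)" by (simp add: v_def)
    qed (use pmf B B0 \<sigma>0 in auto)
    also have "\<dots> \<le> block_expect K as (\<lambda>ys. if 0 \<le> block_sum g as ys then 1 else 0)"
    proof (rule block_expect_mono)
      fix ys :: "'y list"
      have "block_sum h as ys = block_sum g as ys - (\<Sum>a\<leftarrow>as. \<mu> a)"
        by (simp add: block_sum_def h_def sum_subtractf sum_list_sum_nth atLeast0LessThan)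
      then show "(if 0 \<le> block_sum h as ys then 1 else 0) \<le> (if 0 \<le> block_sum g as ys then 1 else (0::real))"
        using mean by (auto simp: \<mu>_def)
    qed (use pmf in auto)
    finally show "1 / (12 * (3 + B / \<sigma>)\<^sup>2)
      \<le> block_expect K as (\<lambda>ys. if 0 \<le> block_sum g as ys then 1 else 0)" .
  qed
qed

section \<open>Joint types\<close>

text \<open>Type counting: a multiset is determined by its count function, whose values lie in
  \<open>{..n}\<close>.\<close>

lemma card_multisets_size_le:
  fixes A :: "'a::finite multiset set"
  assumes "\<And>M. M \<in> A \<Longrightarrow> size M = n"
  shows "finite A" and "card A \<le> (n + 1) ^ CARD('a)"
proof -
  have sub: "count ` A \<subseteq> (UNIV \<rightarrow>\<^sub>E {..n})"
    using assms count_le_size by fastforce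
  have fin: "finite (UNIV \<rightarrow>\<^sub>E {..n} :: ('a \<Rightarrow> nat) set)" by (intro finite_PiE) auto
  have inj: "inj_on count A" by (auto simp: inj_on_def count_inject)
  show "finite A" using finite_subset[OF sub fin] inj finite_imageD by blast
  have "card A = card (count ` A)" using inj by (simp add: card_image)
  also have "\<dots> \<le> card (UNIV \<rightarrow>\<^sub>E {..n} :: ('a \<Rightarrow> nat) set)" by (intro card_mono fin sub)
  finally show "card A \<le> (n + 1) ^ CARD('a)" by (simp add: card_PiE)
qed

text \<open>Joint types are encoded, without normalisation, as multisets of letter pairs.\<close>

definition isolated :: "'x list list \<Rightarrow> nat \<Rightarrow> 'y list \<Rightarrow> bool" where
  "isolated C m zs \<longleftrightarrow>
     (\<forall>m'<length C. m' \<noteq> m \<longrightarrow> mset (zip (C ! m') zs) \<noteq> mset (zip (C ! m) zs))"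

text \<open>Distinct isolated messages have distinct joint types with \<open>zs\<close>, so there
  are no more of them than joint types.\<close>

lemma card_isolated_le:
  fixes C :: "'x::finite list list" and zs :: "'y::finite list"
  assumes "\<And>c. c \<in> set C \<Longrightarrow> length c = length zs"
  shows "card {m. m < length C \<and> isolated C m zs} \<le> (length zs + 1) ^ CARD('x \<times> 'y)"
proof -
  define A where "A = {m. m < length C \<and> isolated C m zs}"
  have inj: "inj_on (\<lambda>m. mset (zip (C ! m) zs)) A"
    unfolding inj_on_def A_def isolated_def by (metis (mono_tags, lifting) mem_Collect_eq)
  have "card A = card ((\<lambda>m. mset (zip (C ! m) zs)) ` A)" using inj by (simp add: card_image)
  also have "\<dots> \<le> (length zs + 1) ^ CARD('x \<times> 'y)"
    by (rule card_multisets_size_le) (auto simp: A_def assms)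
  finally show ?thesis by (simp add: A_def)
qed

section \<open>The maximality condition depends only on supports\<close>

text \<open>Where the marginal vanishes, so do its nonnegative summands; the default value of
  division by zero is therefore harmless when conditioning on \<open>Z\<close>.\<close>

lemma marg_Yhat_times_cond:
  assumes "is_cond_pmf2 V"
  shows "marg_Yhat V x z * (V x y z / marg_Yhat V x z) = V x y z"
proof (cases "marg_Yhat V x z = 0")
  case True
  then have "V x y z = 0" using assms unfolding marg_Yhat_def is_cond_pmf2_def
    by (subst (asm) sum_nonneg_eq_0_iff) auto
  then show ?thesis by simp
qed simp

text \<open>Pushing the coupling \<open>X\<^sub>2 = X\<^sub>1\<close> a little in the direction of a circulation \<open>J\<close> gives an
  admissible conditional law of \<open>X\<^sub>2\<close>, so maximality controls the average of the metric difference
  over \<open>J\<close>, whatever the marginals of \<open>J\<close>.\<close>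

lemma Mmax_circulation:
  fixes q :: "'x::finite \<Rightarrow> 'y::finite \<Rightarrow> real"
  assumes V: "V \<in> Mmax q P" and P: "\<And>x. 0 < P x"
    and J0: "\<And>x1 z x2. 0 \<le> J x1 z x2"
    and supp: "\<And>x1 z x2. J x1 z x2 \<noteq> 0 \<Longrightarrow> 0 < marg_Yhat V x1 z"
    and circ: "\<And>z x. (\<Sum>x1\<in>UNIV. J x1 z x) = (\<Sum>x2\<in>UNIV. J x z x2)"
  shows "0 \<le> (\<Sum>x1\<in>UNIV. \<Sum>z\<in>UNIV. \<Sum>x2\<in>UNIV. J x1 z x2 *
            (\<Sum>y\<in>UNIV. V x1 y z / marg_Yhat V x1 z * (q x2 y - q x1 y)))"
proof -
  define w where "w = (\<lambda>x z. P x * marg_Yhat V x z)"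
  define T where "T = (\<lambda>x z. \<Sum>x2\<in>UNIV. J x z x2)"
  have V0: "0 \<le> V x y z" for x y z using V by (auto simp: Mmax_def is_cond_pmf2_def)
  have h0: "0 \<le> marg_Yhat V x z" for x z unfolding marg_Yhat_def by (intro sum_nonneg V0)
  have w0: "0 \<le> w x z" for x z using h0[of x z] P[of x] by (simp add: w_def)
  have T0: "0 \<le> T x z" for x z unfolding T_def by (intro sum_nonneg J0)
  have Jw: "J x z x2 = 0" if "w x z = 0" for x z x2
    using supp[of x z x2] that P[of x] by (auto simp: w_def)
  then have Tw: "T x z = 0" if "w x z = 0" for x z
    using that by (simp add: T_def)
  \<comment> \<open>This step size keeps the perturbed coupling nonnegative. It exists because the
    outflow \<open>T\<close> vanishes wherever \<open>w\<close> does and only finitely many pairs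
    remain.\<close>
  obtain e where e: "0 < e" "\<And>x z. e * T x z \<le> w x z"
  proof -
    define \<tau> where "\<tau> = (\<Sum>x\<in>UNIV. \<Sum>z\<in>UNIV. T x z) + 1"
    define m where "m = Min (insert 1 {w x z | x z. w x z > 0})"
    have "{w x z | x z. w x z > 0} \<subseteq> (\<lambda>(x, z). w x z) ` UNIV" by auto
    then have fin: "finite {w x z | x z. w x z > 0}" by (rule finite_subset) simp
    have m0: "0 < m" unfolding m_def using fin by (subst Min_gr_iff) auto
    have T\<tau>: "T x z \<le> \<tau>" for x z
    proof -
      have "T x z \<le> (\<Sum>z\<in>UNIV. T x z)" using T0 by (intro member_le_sum) auto
      also have "\<dots> \<le> (\<Sum>x\<in>UNIV. \<Sum>z\<in>UNIV. T x z)"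
        using T0 by (intro member_le_sum[of x UNIV "\<lambda>x. \<Sum>z\<in>UNIV. T x z"]) (auto intro: sum_nonneg)
      finally show ?thesis by (simp add: \<tau>_def)
    qed
    have \<tau>0: "0 < \<tau>" unfolding \<tau>_def using T0 by (intro add_nonneg_pos sum_nonneg) auto
    have "m / \<tau> * T x z \<le> w x z" for x z
    proof (cases "w x z = 0")
      case False
      then have "0 < w x z" using w0[of x z] by simp
      then have "m \<le> w x z" unfolding m_def using fin by (intro Min_le) auto
      moreover have "m / \<tau> * T x z \<le> m / \<tau> * \<tau>" using m0 \<tau>0 T\<tau> by (intro mult_left_mono) auto
      ultimately show ?thesis using \<tau>0 by simp
    qed (simp add: Tw)
    then show ?thesis using that[of "m / \<tau>"] m0 \<tau>0 by simp
  qed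
  define I where "I = (\<lambda>x1 x2 :: 'x. if x1 = x2 then 1 else 0 :: real)"
  have sumI: "(\<Sum>x2\<in>UNIV. I x1 x2 * f x2) = f x1" "(\<Sum>x1\<in>UNIV. f x1 * I x1 x2) = f x2"
    for f x1 x2 by (simp_all add: I_def if_distrib[of "\<lambda>t. t * _"] if_distrib[of "(*) _"] cong: if_cong)
  \<comment> \<open>A mass \<open>e * J\<close> is moved from \<open>x1\<close> to
    \<open>x2\<close>, and the total \<open>e * T\<close> is taken from the mass that stays at
    \<open>x1\<close>. Where \<open>w\<close> is zero the quotient is 0 and \<open>U\<close> is the
    identity kernel.\<close>
  define U where "U = (\<lambda>x1 z x2. I x1 x2 + e * (J x1 z x2 - T x1 z * I x1 x2) / w x1 z)"
  have wU: "w x1 z * U x1 z x2 = w x1 z * I x1 x2 + e * (J x1 z x2 - T x1 z * I x1 x2)" for x1 z x2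
    by (cases "w x1 z = 0") (simp_all add: U_def Jw Tw field_simps)
  have pmf: "is_pmf (U x1 z)" for x1 z
    unfolding is_pmf_def
  proof (intro conjI allI)
    fix x2
    have "0 \<le> U x1 z x2" if "w x1 z \<noteq> 0"
    proof -
      have "0 \<le> w x1 z * U x1 z x2"
        unfolding wU using e(2)[of x1 z] w0[of x1 z] mult_nonneg_nonneg[OF less_imp_le[OF e(1)] J0[of x1 z x2]]
        by (auto simp: I_def right_diff_distrib)
      then show ?thesis using w0[of x1 z] that by (simp add: zero_le_mult_iff)
    qed
    then show "0 \<le> U x1 z x2" by (cases "w x1 z = 0") (simp_all add: U_def I_def)
    have "(\<Sum>x2\<in>UNIV. U x1 z x2)
        = (\<Sum>x2\<in>UNIV. I x1 x2 * 1) + e * (T x1 z - (\<Sum>x2\<in>UNIV. I x1 x2 * T x1 z)) / w x1 z"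
      unfolding U_def sum.distrib sum_divide_distrib[symmetric] sum_distrib_left[symmetric] sum_subtractf
      by (simp add: T_def mult.commute sum_distrib_right)
    then show "(\<Sum>x2\<in>UNIV. U x1 z x2) = 1" by (simp only: sumI) simp
  qed
  \<comment> \<open>Inflow and outflow of \<open>J\<close> at \<open>x2\<close> agree, so the two
    corrections cancel in this marginal.\<close>
  have marg: "(\<Sum>x1\<in>UNIV. \<Sum>y\<in>UNIV. P x1 * V x1 y z * U x1 z x2) = (\<Sum>y\<in>UNIV. P x2 * V x2 y z)" for z x2
  proof -
    have "(\<Sum>x1\<in>UNIV. \<Sum>y\<in>UNIV. P x1 * V x1 y z * U x1 z x2) = (\<Sum>x1\<in>UNIV. w x1 z * U x1 z x2)"
      by (simp add: w_def marg_Yhat_def sum_distrib_left sum_distrib_right)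
    also have "\<dots> = (\<Sum>x1\<in>UNIV. w x1 z * I x1 x2)
        + e * ((\<Sum>x1\<in>UNIV. J x1 z x2) - (\<Sum>x1\<in>UNIV. T x1 z * I x1 x2))"
      by (simp add: wU sum.distrib sum_subtractf sum_distrib_left right_diff_distrib)
    also have "\<dots> = w x2 z" by (simp only: sumI circ) (simp add: T_def)
    finally show ?thesis by (simp add: w_def marg_Yhat_def sum_distrib_left)
  qed
  define \<phi> where "\<phi> = (\<lambda>x1 z x2. \<Sum>y\<in>UNIV. V x1 y z / marg_Yhat V x1 z * q x2 y)"
  have Vh: "V x y z = marg_Yhat V x z * (V x y z / marg_Yhat V x z)" for x y z
    using V by (intro marg_Yhat_times_cond[symmetric]) (simp add: Mmax_def)
  have lhs: "(\<Sum>x1\<in>UNIV. \<Sum>y\<in>UNIV. \<Sum>z\<in>UNIV. \<Sum>x2\<in>UNIV. P x1 * V x1 y z * A x1 z x2 * q x2 y)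
      = (\<Sum>x1\<in>UNIV. \<Sum>z\<in>UNIV. \<Sum>x2\<in>UNIV. w x1 z * A x1 z x2 * \<phi> x1 z x2)" for A
  proof -
    have "(\<Sum>x1\<in>UNIV. \<Sum>y\<in>UNIV. \<Sum>z\<in>UNIV. \<Sum>x2\<in>UNIV. P x1 * V x1 y z * A x1 z x2 * q x2 y)
       = (\<Sum>x1\<in>UNIV. \<Sum>z\<in>UNIV. \<Sum>x2\<in>UNIV. \<Sum>y\<in>UNIV. P x1 * V x1 y z * A x1 z x2 * q x2 y)"
      by (subst sum.swap[of _ "UNIV :: 'y set" "UNIV :: 'y set"], subst sum.swap[of _ "UNIV :: 'x set" "UNIV :: 'y set"]) (rule refl)
    also have "\<dots> = (\<Sum>x1\<in>UNIV. \<Sum>z\<in>UNIV. \<Sum>x2\<in>UNIV. w x1 z * A x1 z x2 * \<phi> x1 z x2)"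
      unfolding \<phi>_def w_def sum_distrib_left by (intro sum.cong refl) (subst Vh, simp add: mult_ac)
    finally show ?thesis .
  qed
  \<comment> \<open>The identity coupling reproduces the right-hand side of the maximality
    inequality. The objective is linear in the coupling, so the gain is exactly \<open>e\<close>
    times the average over the perturbation.\<close>
  have "(\<Sum>x1\<in>UNIV. \<Sum>y\<in>UNIV. \<Sum>z\<in>UNIV. \<Sum>x2\<in>UNIV. P x1 * V x1 y z * I x1 x2 * q x2 y)
     = (\<Sum>x1\<in>UNIV. \<Sum>y\<in>UNIV. \<Sum>z\<in>UNIV. P x1 * V x1 y z * q x1 y)"
    by (simp add: mult.assoc sum_distrib_left[symmetric] sumI)
  also have "\<dots> \<le> (\<Sum>x1\<in>UNIV. \<Sum>y\<in>UNIV. \<Sum>z\<in>UNIV. \<Sum>x2\<in>UNIV. P x1 * V x1 y z * U x1 z x2 * q x2 y)"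
    using V pmf marg unfolding Mmax_def by blast
  finally have "(\<Sum>x1\<in>UNIV. \<Sum>y\<in>UNIV. \<Sum>z\<in>UNIV. \<Sum>x2\<in>UNIV. P x1 * V x1 y z * I x1 x2 * q x2 y)
      \<le> (\<Sum>x1\<in>UNIV. \<Sum>y\<in>UNIV. \<Sum>z\<in>UNIV. \<Sum>x2\<in>UNIV. P x1 * V x1 y z * U x1 z x2 * q x2 y)" .
  then have "0 \<le> (\<Sum>x1\<in>UNIV. \<Sum>z\<in>UNIV. \<Sum>x2\<in>UNIV. w x1 z * U x1 z x2 * \<phi> x1 z x2)
      - (\<Sum>x1\<in>UNIV. \<Sum>z\<in>UNIV. \<Sum>x2\<in>UNIV. w x1 z * I x1 x2 * \<phi> x1 z x2)"
    unfolding lhs[of U] lhs[of "\<lambda>x1 z x2. I x1 x2"] by simp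
  also have "\<dots> = e * (\<Sum>x1\<in>UNIV. \<Sum>z\<in>UNIV. \<Sum>x2\<in>UNIV. (J x1 z x2 - T x1 z * I x1 x2) * \<phi> x1 z x2)"
    unfolding wU sum_subtractf[symmetric] sum_distrib_left by (simp add: algebra_simps)
  finally have "0 \<le> (\<Sum>x1\<in>UNIV. \<Sum>z\<in>UNIV. \<Sum>x2\<in>UNIV. (J x1 z x2 - T x1 z * I x1 x2) * \<phi> x1 z x2)"
    using e(1) by (simp add: zero_le_mult_iff)
  also have "\<dots> = (\<Sum>x1\<in>UNIV. \<Sum>z\<in>UNIV. \<Sum>x2\<in>UNIV. J x1 z x2 * (\<phi> x1 z x2 - \<phi> x1 z x1))"
  proof (rule sum.cong[OF refl], rule sum.cong[OF refl])
    fix x1 z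
    have "(\<Sum>x2\<in>UNIV. (J x1 z x2 - T x1 z * I x1 x2) * \<phi> x1 z x2)
       = (\<Sum>x2\<in>UNIV. J x1 z x2 * \<phi> x1 z x2) - T x1 z * (\<Sum>x2\<in>UNIV. I x1 x2 * \<phi> x1 z x2)"
      by (simp add: algebra_simps sum_subtractf sum_distrib_left)
    also have "\<dots> = (\<Sum>x2\<in>UNIV. J x1 z x2 * (\<phi> x1 z x2 - \<phi> x1 z x1))"
      unfolding sumI by (simp add: right_diff_distrib sum_subtractf sum_distrib_right T_def)
    finally show "(\<Sum>x2\<in>UNIV. (J x1 z x2 - T x1 z * I x1 x2) * \<phi> x1 z x2)
      = (\<Sum>x2\<in>UNIV. J x1 z x2 * (\<phi> x1 z x2 - \<phi> x1 z x1))" .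
  qed
  finally show ?thesis
    by (simp add: \<phi>_def right_diff_distrib sum_subtractf)
qed

text \<open>When the auxiliary output equals \<open>Y\<close>, the marginal constraint fixes the law
  of \<open>(X2, Y)\<close> and the two expectations coincide. This makes the inner minimisation
  feasible for every \<open>P\<close>.\<close>

lemma diagonal_in_Mmax:
  fixes q :: "'x::finite \<Rightarrow> 'y::finite \<Rightarrow> real"
  assumes "is_channel W"
  defines "V \<equiv> (\<lambda>x y z. if z = y then W x y else 0)"
  shows "V \<in> Mmax q P" and "marg_Y V = W" and "marg_Yhat V = W"
proof -
  show "marg_Y V = W" "marg_Yhat V = W"
    by (auto simp: marg_Y_def marg_Yhat_def V_def fun_eq_iff)
  have sumV: "(\<Sum>z\<in>UNIV. P x * V x y z * f z) = P x * W x y * f y" for x y f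
    by (simp add: V_def if_distrib[of "\<lambda>t. t * _"] if_distrib[of "(*) _"] cong: if_cong)
  have sumV': "(\<Sum>y\<in>UNIV. P x * V x y z * f y) = P x * W x z * f z" for x z f
    by (simp add: V_def if_distrib[of "\<lambda>t. t * _"] if_distrib[of "(*) _"] cong: if_cong)
  have "is_cond_pmf2 V"
    using assms(1) by (simp add: is_cond_pmf2_def is_channel_def is_pmf_def V_def)
  moreover
  { fix U :: "'x \<Rightarrow> 'y \<Rightarrow> 'x \<Rightarrow> real"
    assume "\<forall>z x2. (\<Sum>x1\<in>UNIV. \<Sum>y\<in>UNIV. P x1 * V x1 y z * U x1 z x2) = (\<Sum>y\<in>UNIV. P x2 * V x2 y z)"
    then have U: "(\<Sum>x1\<in>UNIV. P x1 * W x1 z * U x1 z x2) = P x2 * W x2 z" for z x2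
      using sumV'[of _ z "\<lambda>_. U _ z x2"] sumV'[of x2 z "\<lambda>_. 1"] by (simp add: sumV')
    have "(\<Sum>x1\<in>UNIV. \<Sum>y\<in>UNIV. \<Sum>z\<in>UNIV. \<Sum>x2\<in>UNIV. P x1 * V x1 y z * U x1 z x2 * q x2 y)
        = (\<Sum>x1\<in>UNIV. \<Sum>y\<in>UNIV. \<Sum>x2\<in>UNIV. P x1 * W x1 y * U x1 y x2 * q x2 y)"
    proof (intro sum.cong refl)
      fix x1 y
      show "(\<Sum>z\<in>UNIV. \<Sum>x2\<in>UNIV. P x1 * V x1 y z * U x1 z x2 * q x2 y)
          = (\<Sum>x2\<in>UNIV. P x1 * W x1 y * U x1 y x2 * q x2 y)"
        using sumV[of x1 y "\<lambda>z. \<Sum>x2\<in>UNIV. U x1 z x2 * q x2 y"]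
        by (simp add: sum_distrib_left mult.assoc)
    qed
    also have "\<dots> = (\<Sum>y\<in>UNIV. \<Sum>x2\<in>UNIV. \<Sum>x1\<in>UNIV. P x1 * W x1 y * U x1 y x2 * q x2 y)"
      by (subst sum.swap, subst (2) sum.swap) (rule refl)
    also have "\<dots> = (\<Sum>y\<in>UNIV. \<Sum>x2\<in>UNIV. P x2 * W x2 y * q x2 y)"
      by (simp add: sum_distrib_right[symmetric] U)
    also have "\<dots> = (\<Sum>x1\<in>UNIV. \<Sum>y\<in>UNIV. \<Sum>z\<in>UNIV. P x1 * V x1 y z * q x1 y)"
      by (subst sum.swap) (simp add: sumV)
    finally have "(\<Sum>x1\<in>UNIV. \<Sum>y\<in>UNIV. \<Sum>z\<in>UNIV. \<Sum>x2\<in>UNIV. P x1 * V x1 y z * U x1 z x2 * q x2 y)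
        = (\<Sum>x1\<in>UNIV. \<Sum>y\<in>UNIV. \<Sum>z\<in>UNIV. P x1 * V x1 y z * q x1 y)" . }
  ultimately show "V \<in> Mmax q P" unfolding Mmax_def by auto
qed

section \<open>Confusable codewords cause decoding errors\<close>

lemma is_channel_marg_Yhat:
  assumes "is_cond_pmf2 V"
  shows "is_channel (marg_Yhat V)"
proof -
  have "(\<Sum>z\<in>UNIV. \<Sum>y\<in>UNIV. V x y z) = 1" for x
    using assms by (subst sum.swap) (auto simp: is_cond_pmf2_def)
  then show ?thesis using assms
    by (auto simp: is_channel_def is_pmf_def marg_Yhat_def is_cond_pmf2_def intro!: sum_nonneg)
qed

text \<open>Tower rule, letter by letter: first draw \<open>Z\<close>, then \<open>Y\<close> given
  the input and \<open>Z\<close>.\<close>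

lemma block_expect_marg_Y:
  fixes V :: "'x \<Rightarrow> 'y::finite \<Rightarrow> 'y \<Rightarrow> real"
  assumes "is_cond_pmf2 V"
  shows "block_expect (marg_Y V) xs F = block_expect (marg_Yhat V) xs
           (\<lambda>zs. block_expect (\<lambda>(x, z) y. V x y z / marg_Yhat V x z) (zip xs zs) F)"
proof (induction xs arbitrary: F)
  case (Cons x xs)
  let ?K = "\<lambda>(x, z) y. V x y z / marg_Yhat V x z"
  have "block_expect (marg_Yhat V) (x # xs) (\<lambda>zs. block_expect ?K (zip (x # xs) zs) F)
    = (\<Sum>z\<in>UNIV. marg_Yhat V x z * (\<Sum>y\<in>UNIV. V x y z / marg_Yhat V x z *
        block_expect (marg_Y V) xs (\<lambda>ys. F (y # ys))))"
    by (simp add: block_expect_Cons block_expect_sum block_expect_cmult Cons.IH[symmetric]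
        del: times_divide_eq_left times_divide_eq_right)
  also have "\<dots> = (\<Sum>z\<in>UNIV. \<Sum>y\<in>UNIV. V x y z * block_expect (marg_Y V) xs (\<lambda>ys. F (y # ys)))"
    by (simp add: sum_distrib_left mult.assoc[symmetric] marg_Yhat_times_cond[OF assms]
        del: times_divide_eq_left times_divide_eq_right)
  also have "\<dots> = (\<Sum>y\<in>UNIV. marg_Y V x y * block_expect (marg_Y V) xs (\<lambda>ys. F (y # ys)))"
    by (subst sum.swap) (simp add: marg_Y_def sum_distrib_right)
  finally show ?case by (simp add: block_expect_Cons)
qed simp

lemma sum_eq_if_mset_zip_eq:
  fixes f :: "'a \<times> 'b \<Rightarrow> real"
  assumes "mset (zip xs zs) = mset (zip xs' zs)" "length xs = length zs" "length xs' = length zs"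
  shows "(\<Sum>i<length zs. f (xs ! i, zs ! i)) = (\<Sum>i<length zs. f (xs' ! i, zs ! i))"
proof -
  have "(\<Sum>p\<leftarrow>zip xs zs. f p) = (\<Sum>p\<leftarrow>zip xs' zs. f p)"
    using assms(1) by (metis mset_map sum_mset_sum_list)
  then show ?thesis using assms(2,3)
    by (simp add: sum_list_sum_nth atLeast0LessThan)
qed

text \<open>The counts \<open>J\<close> of the triples formed by \<open>xs\<close>,
  \<open>zs\<close> and \<open>xs'\<close> are a flow from the letters of \<open>xs\<close> to those
  of \<open>xs'\<close>, separately for each letter of \<open>zs\<close>. Equality of the joint
  types says that outflow equals inflow, so \<open>Mmax_circulation\<close> applies.\<close>

lemma mean_metric_difference_nonneg:
  fixes q :: "'x::finite \<Rightarrow> 'y::finite \<Rightarrow> real"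
  assumes V: "V \<in> Mmax q P" and P: "\<And>x. 0 < P x"
    and len: "length xs = length zs" "length xs' = length zs"
    and type: "mset (zip xs zs) = mset (zip xs' zs)"
    and supp: "\<And>i. i < length zs \<Longrightarrow> 0 < marg_Yhat V (xs ! i) (zs ! i)"
  shows "0 \<le> (\<Sum>i<length zs. \<Sum>y\<in>UNIV. V (xs ! i) y (zs ! i) / marg_Yhat V (xs ! i) (zs ! i)
                * (q (xs' ! i) y - q (xs ! i) y))"
proof -
  define t where "t = (\<lambda>i. (xs ! i, zs ! i, xs' ! i))"
  define J where "J = (\<lambda>x1 z x2. \<Sum>i<length zs. if (x1, z, x2) = t i then 1 else 0 :: real)"
  define d where "d = (\<lambda>(x1, z, x2). \<Sum>y\<in>UNIV. V x1 y z / marg_Yhat V x1 z * (q x2 y - q x1 y))"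
  have "0 \<le> (\<Sum>x1\<in>UNIV. \<Sum>z\<in>UNIV. \<Sum>x2\<in>UNIV. J x1 z x2 *
            (\<Sum>y\<in>UNIV. V x1 y z / marg_Yhat V x1 z * (q x2 y - q x1 y)))"
  proof (rule Mmax_circulation[OF V P])
    show "0 \<le> J x1 z x2" for x1 z x2 unfolding J_def by (intro sum_nonneg) auto
    show "0 < marg_Yhat V x1 z" if "J x1 z x2 \<noteq> 0" for x1 z x2
    proof -
      have "\<exists>i<length zs. (x1, z, x2) = t i"
        by (rule ccontr) (use that in \<open>simp add: J_def\<close>)
      then obtain i where "i < length zs" "(x1, z, x2) = t i" by blast
      then show ?thesis using supp[of i] by (simp add: t_def)
    qed
    show "(\<Sum>x1\<in>UNIV. J x1 z x) = (\<Sum>x2\<in>UNIV. J x z x2)" for z x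
    proof -
      have "(\<Sum>x1\<in>UNIV. J x1 z x) = (\<Sum>i<length zs. if (xs' ! i, zs ! i) = (x, z) then 1 else 0)"
        unfolding J_def by (subst sum.swap) (auto intro!: sum.cong simp: t_def)
      also have "\<dots> = (\<Sum>i<length zs. if (xs ! i, zs ! i) = (x, z) then 1 else 0)"
        using sum_eq_if_mset_zip_eq[OF type len, of "\<lambda>p. if p = (x, z) then 1 else 0"] by simp
      also have "\<dots> = (\<Sum>x2\<in>UNIV. J x z x2)"
        unfolding J_def by (subst sum.swap) (auto intro!: sum.cong simp: t_def)
      finally show ?thesis .
    qed
  qed
  also have "\<dots> = (\<Sum>(x1, z, x2)\<in>UNIV. J x1 z x2 * d (x1, z, x2))"
    by (simp add: sum.cartesian_product d_def UNIV_Times_UNIV[symmetric] del: UNIV_Times_UNIV)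
  also have "\<dots> = (\<Sum>p\<in>UNIV. \<Sum>i<length zs. if p = t i then d p else 0)"
    by (intro sum.cong refl) (auto simp: J_def sum_distrib_right intro!: sum.cong)
  also have "\<dots> = (\<Sum>i<length zs. d (t i))"
    by (subst sum.swap) simp
  finally show ?thesis by (simp add: d_def t_def)
qed

text \<open>Given \<open>zs\<close>, the metric difference is a sum of independent terms whose laws
  are indexed by the finite set of triples \<open>(x1, z, x2)\<close>. Hence one \<open>c\<close>
  serves all lengths and all words.\<close>

lemma error_prob_if_confusable:
  fixes q :: "'x::finite \<Rightarrow> 'y::finite \<Rightarrow> real"
  assumes V: "V \<in> Mmax q P" and P: "\<And>x. 0 < P x"
  shows "\<exists>c>0. \<forall>xs xs' zs. length xs = length zs \<longrightarrow> length xs' = length zs \<longrightarrow>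
           mset (zip xs zs) = mset (zip xs' zs) \<longrightarrow>
           (\<forall>i<length zs. 0 < marg_Yhat V (xs ! i) (zs ! i)) \<longrightarrow>
           c \<le> block_expect (\<lambda>(x, z) y. V x y z / marg_Yhat V x z) (zip xs zs)
                  (\<lambda>ys. if qn q (length zs) xs ys \<le> qn q (length zs) xs' ys then 1 else 0)"
proof -
  define K where "K = (\<lambda>(x1, z, x2 :: 'x) y. V x1 y z / marg_Yhat V x1 z)"
  define g where "g = (\<lambda>(x1, z :: 'y, x2) y. q x2 y - q x1 y)"
  obtain c where c: "0 < c" "\<And>as. (\<forall>a\<in>set as. is_pmf (K a)) \<Longrightarrow>
           0 \<le> (\<Sum>a\<leftarrow>as. \<Sum>y\<in>UNIV. K a y * g a y) \<Longrightarrow>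
           c \<le> block_expect K as (\<lambda>ys. if 0 \<le> block_sum g as ys then 1 else 0)"
    using nonneg_mean_sum_prob[of K g] by blast
  show ?thesis
  proof (intro exI[of _ c] conjI allI impI c(1))
    fix xs xs' zs
    assume len: "length xs = length zs" "length xs' = length zs"
      and type: "mset (zip xs zs) = mset (zip xs' zs)"
      and supp: "\<forall>i<length zs. 0 < marg_Yhat V (xs ! i) (zs ! i)"
    define as where "as = zip xs (zip zs xs')"
    have as: "length as = length zs" "\<And>i. i < length zs \<Longrightarrow> as ! i = (xs ! i, zs ! i, xs' ! i)"
      using len by (auto simp: as_def)
    have "c \<le> block_expect K as (\<lambda>ys. if 0 \<le> block_sum g as ys then 1 else 0)"
    proof (rule c(2))
      show "\<forall>a\<in>set as. is_pmf (K a)"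
      proof
        fix a assume "a \<in> set as"
        then obtain i where "i < length zs" "a = (xs ! i, zs ! i, xs' ! i)"
          by (metis as in_set_conv_nth)
        then obtain x z x2 where a: "a = (x, z, x2)" "0 < marg_Yhat V x z"
          using supp by auto
        have V0: "0 \<le> V x y z" for y using V by (auto simp: Mmax_def is_cond_pmf2_def)
        have "(\<Sum>y\<in>UNIV. V x y z / marg_Yhat V x z) = 1"
          using a(2) by (simp add: sum_divide_distrib[symmetric] marg_Yhat_def)
        then show "is_pmf (K a)"
          using a V0 by (auto simp: is_pmf_def K_def)
      qed
      show "0 \<le> (\<Sum>a\<leftarrow>as. \<Sum>y\<in>UNIV. K a y * g a y)"
        using mean_metric_difference_nonneg[OF V P len type] supp
        by (simp add: sum_list_sum_nth atLeast0LessThan as K_def g_def)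
    qed
    also have "\<dots> = block_expect (\<lambda>(x, z) y. V x y z / marg_Yhat V x z) (zip xs zs)
                  (\<lambda>ys. if qn q (length zs) xs ys \<le> qn q (length zs) xs' ys then 1 else 0)"
      using len by (intro block_expect_cong)
        (auto simp: as K_def g_def block_sum_def qn_def sum_subtractf)
    finally show "c \<le> block_expect (\<lambda>(x, z) y. V x y z / marg_Yhat V x z) (zip xs zs)
                  (\<lambda>ys. if qn q (length zs) xs ys \<le> qn q (length zs) xs' ys then 1 else 0)" .
  qed
qed

text \<open>Condition on \<open>Z\<close>. If the message is not isolated, some competitor has the
  same joint type and reaches at least the metric of the sent word with probability at least
  \<open>c\<close>; ties count as errors. Isolated outcomes contribute the trivial bound 0.\<close>

lemma codeword_error_lower_bound:
  fixes q :: "'x::finite \<Rightarrow> 'y::finite \<Rightarrow> real"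
  assumes V: "V \<in> Mmax q P" and P: "\<And>x. 0 < P x"
  shows "\<exists>c>0. \<forall>n C m. is_codebook n C \<longrightarrow> m < length C \<longrightarrow>
     c * (1 - block_expect (marg_Yhat V) (C ! m) (\<lambda>zs. if isolated C m zs then 1 else 0))
     \<le> (\<Sum>ys | length ys = n.
          if \<exists>m'<length C. m' \<noteq> m \<and> qn q n (C ! m') ys \<ge> qn q n (C ! m) ys
          then Wn (marg_Y V) n (C ! m) ys else 0)"
proof -
  let ?K = "\<lambda>(x, z) y. V x y z / marg_Yhat V x z"
  have cp: "is_cond_pmf2 V" using V by (simp add: Mmax_def)
  then have ch: "is_pmf (marg_Yhat V x)" for x
    using is_channel_marg_Yhat by (auto simp: is_channel_def)
  obtain c where c: "0 < c" "\<forall>xs xs' zs. length xs = length zs \<longrightarrow> length xs' = length zs \<longrightarrow>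
           mset (zip xs zs) = mset (zip xs' zs) \<longrightarrow>
           (\<forall>i<length zs. 0 < marg_Yhat V (xs ! i) (zs ! i)) \<longrightarrow>
           c \<le> block_expect ?K (zip xs zs)
                  (\<lambda>ys. if qn q (length zs) xs ys \<le> qn q (length zs) xs' ys then 1 else 0)"
    using error_prob_if_confusable[OF assms] by (elim exE conjE) (rule that)
  show ?thesis
  proof (intro exI[of _ c] conjI allI impI c(1))
    fix n m and C :: "'x list list" assume C: "is_codebook n C" and m: "m < length C"
    define e where "e = (\<lambda>ys. if \<exists>m'<length C. m' \<noteq> m \<and> qn q n (C ! m') ys \<ge> qn q n (C ! m) ys
      then 1 else 0 :: real)"
    let ?xs = "C ! m"
    have len: "length (C ! m') = n" if "m' < length C" for m' using C that by (auto simp: is_codebook_def)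
    have "c * (1 - block_expect (marg_Yhat V) ?xs (\<lambda>zs. if isolated C m zs then 1 else 0))
       = block_expect (marg_Yhat V) ?xs (\<lambda>zs. c * (1 - (if isolated C m zs then 1 else 0)))"
      by (simp only: block_expect_cmult block_expect_diff block_expect_const[OF ch])
    also have "\<dots> \<le> block_expect (marg_Yhat V) ?xs (\<lambda>zs. block_expect ?K (zip ?xs zs) e)"
    proof (rule block_expect_mono[OF ch])
      fix zs :: "'y list"
      assume zs: "length zs = length ?xs"
        and ne: "(\<Prod>i<length ?xs. marg_Yhat V (?xs ! i) (zs ! i)) \<noteq> 0"
      have n: "n = length zs" using zs len m by simp
      \<comment> \<open>Positive weight of \<open>zs\<close> makes the conditional kernel a pmf at
        every letter pair that occurs.\<close>
      have pos: "\<forall>i<length zs. 0 < marg_Yhat V (?xs ! i) (zs ! i)"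
        using ne zs ch by (auto simp: is_pmf_def less_le)
      have pmfK: "is_pmf (?K a)" if in_zip: "a \<in> set (zip ?xs zs)" for a
      proof -
        obtain x z where a: "a = (x, z)" "0 < marg_Yhat V x z"
          using in_zip pos zs by (auto simp: set_zip)
        have "(\<Sum>y\<in>UNIV. V x y z / marg_Yhat V x z) = 1"
          using a(2) by (simp add: sum_divide_distrib[symmetric] marg_Yhat_def)
        then show ?thesis using a cp by (auto simp: is_pmf_def is_cond_pmf2_def)
      qed
      show "c * (1 - (if isolated C m zs then 1 else 0)) \<le> block_expect ?K (zip ?xs zs) e"
      proof (cases "isolated C m zs")
        case True
        have "block_expect ?K (zip ?xs zs) (\<lambda>_. 0) \<le> block_expect ?K (zip ?xs zs) e"
          by (rule block_expect_mono[OF pmfK]) (auto simp: e_def)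
        then show ?thesis using True by (simp add: block_expect_const[OF pmfK])
      next
        case False
        then obtain m' where m': "m' < length C" "m' \<noteq> m" "mset (zip (C ! m') zs) = mset (zip ?xs zs)"
          by (auto simp: isolated_def)
        have "c \<le> block_expect ?K (zip ?xs zs)
                  (\<lambda>ys. if qn q (length zs) ?xs ys \<le> qn q (length zs) (C ! m') ys then 1 else 0)"
          using m' zs len m pos by (intro c(2)[rule_format]) auto
        also have "\<dots> \<le> block_expect ?K (zip ?xs zs) e"
          by (rule block_expect_mono[OF pmfK]) (use m' n in \<open>auto simp: e_def\<close>)
        finally show ?thesis using False by simp
      qed
    qed
    also have "\<dots> = block_expect (marg_Y V) ?xs e"
      by (rule block_expect_marg_Y[OF cp, symmetric])
    also have "\<dots> = (\<Sum>ys | length ys = n.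
          if \<exists>m'<length C. m' \<noteq> m \<and> qn q n (C ! m') ys \<ge> qn q n (C ! m) ys
          then Wn (marg_Y V) n (C ! m) ys else 0)"
      unfolding block_expect_def len[OF m] by (intro sum.cong) (auto simp: e_def Wn_def)
    finally show "c * (1 - block_expect (marg_Yhat V) (C ! m) (\<lambda>zs. if isolated C m zs then 1 else 0))
     \<le> (\<Sum>ys | length ys = n.
          if \<exists>m'<length C. m' \<noteq> m \<and> qn q n (C ! m') ys \<ge> qn q n (C ! m) ys
          then Wn (marg_Y V) n (C ! m) ys else 0)" .
  qed
qed

section \<open>Information bounds\<close>

definition divergence :: "('y::finite \<Rightarrow> real) \<Rightarrow> ('y \<Rightarrow> real) \<Rightarrow> real" where
  "divergence v Q = (\<Sum>y\<in>UNIV. v y * log 2 (v y / Q y))"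

definition output_pmf :: "('x::finite \<Rightarrow> real) \<Rightarrow> ('x \<Rightarrow> 'y \<Rightarrow> real) \<Rightarrow> 'y \<Rightarrow> real" where
  "output_pmf P V y = (\<Sum>x\<in>UNIV. P x * V x y)"

lemma divergence_nonneg:
  assumes "is_pmf v" "is_pmf Q" "\<And>y. 0 < v y \<Longrightarrow> 0 < Q y"
  shows "0 \<le> divergence v Q"
proof -
  have "(\<Sum>y\<in>UNIV. (v y - Q y) / ln 2) \<le> divergence v Q"
    unfolding divergence_def
  proof (rule sum_mono)
    fix y
    show "(v y - Q y) / ln 2 \<le> v y * log 2 (v y / Q y)"
    proof (cases "v y = 0")
      case True
      then show ?thesis using assms(2) by (simp add: is_pmf_def)
    next
      case False
      then have v: "0 < v y" using assms(1) by (simp add: is_pmf_def less_le)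
      then have Q: "0 < Q y" by (rule assms(3))
      have "ln (Q y / v y) \<le> Q y / v y - 1" using v Q by (intro ln_le_minus_one) simp
      then have "v y * ln (Q y / v y) \<le> Q y - v y" using v by (simp add: field_simps)
      then have "v y - Q y \<le> v y * ln (v y / Q y)" using v Q by (simp add: ln_div algebra_simps)
      then show ?thesis by (simp add: log_def divide_right_mono)
    qed
  qed
  moreover have "(\<Sum>y\<in>UNIV. (v y - Q y) / ln 2) = 0"
    using assms(1,2) by (simp add: is_pmf_def sum_divide_distrib[symmetric] sum_subtractf)
  ultimately show ?thesis by simp
qed

lemma mutual_info_eq_divergence:
  "mutual_info P V = (\<Sum>x\<in>UNIV. P x * divergence (V x) (output_pmf P V))"
  unfolding mutual_info_def divergence_def output_pmf_def sum_distrib_left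
  by (intro sum.cong refl) auto

lemma is_pmf_output_pmf:
  assumes "is_pmf P" "is_channel V"
  shows "is_pmf (output_pmf P V)"
proof -
  have "(\<Sum>y\<in>UNIV. \<Sum>x\<in>UNIV. P x * V x y) = 1"
    using assms by (subst sum.swap) (simp add: is_pmf_def is_channel_def sum_distrib_left[symmetric])
  then show ?thesis using assms
    by (auto simp: is_pmf_def output_pmf_def is_channel_def intro!: sum_nonneg)
qed

lemma output_pmf_ge:
  assumes "is_pmf P" "is_channel V"
  shows "P x * V x y \<le> output_pmf P V y"
  unfolding output_pmf_def using assms
  by (intro member_le_sum[of x UNIV "\<lambda>x. P x * V x y"]) (auto simp: is_pmf_def is_channel_def)

lemma divergence_output_nonneg:
  assumes "is_pmf P" "is_channel V" "0 < P x"
  shows "0 \<le> divergence (V x) (output_pmf P V)"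
proof (rule divergence_nonneg)
  show "0 < output_pmf P V y" if "0 < V x y" for y
    using output_pmf_ge[OF assms(1,2), of x y] mult_pos_pos[OF assms(3) that] by linarith
qed (use assms is_pmf_output_pmf in \<open>auto simp: is_channel_def\<close>)

lemma mutual_info_nonneg:
  assumes "is_pmf P" "is_channel V"
  shows "0 \<le> mutual_info P V"
  unfolding mutual_info_eq_divergence
proof (rule sum_nonneg)
  fix x
  have "0 \<le> P x" using assms(1) by (simp add: is_pmf_def)
  then show "0 \<le> P x * divergence (V x) (output_pmf P V)"
    using divergence_output_nonneg[OF assms, of x] by (cases "P x = 0") auto
qed

text \<open>By \<open>ln t \<le> t - 1\<close> each summand is at most \<open>1 / ln 2\<close>. This
  crude bound makes the supremum in \<open>Rbar\<close> finite and later fixes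
  \<open>\<eta>\<close>.\<close>

lemma mutual_info_le:
  fixes P :: "'x::finite \<Rightarrow> real" and V :: "'x \<Rightarrow> 'y::finite \<Rightarrow> real"
  assumes "is_pmf P" "is_channel V"
  shows "mutual_info P V \<le> CARD('x) * CARD('y) / ln 2"
proof -
  have "mutual_info P V \<le> (\<Sum>x\<in>(UNIV::'x set). \<Sum>y\<in>(UNIV::'y set). 1 / ln 2)"
    unfolding mutual_info_eq_divergence divergence_def sum_distrib_left
  proof (intro sum_mono)
    fix x y
    define Q where "Q = output_pmf P V y"
    show "P x * (V x y * log 2 (V x y / output_pmf P V y)) \<le> 1 / ln 2"
    proof (cases "P x = 0 \<or> V x y = 0")
      case False
      then have p: "0 < P x" "0 < V x y"
        using assms by (auto simp: is_pmf_def is_channel_def less_le)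
      have V1: "V x y \<le> 1"
        using assms(2) member_le_sum[of y UNIV "V x"] by (auto simp: is_pmf_def is_channel_def)
      have Q: "P x * V x y \<le> Q" unfolding Q_def by (rule output_pmf_ge[OF assms])
      then have Q0: "0 < Q" using mult_pos_pos[OF p] by linarith
      have "ln (V x y / Q) \<le> V x y / Q - 1" using p Q0 by (intro ln_le_minus_one) simp
      then have "P x * V x y * ln (V x y / Q) \<le> P x * V x y * (V x y / Q)"
        using p by (intro mult_left_mono) auto
      also have "\<dots> = (P x * V x y / Q) * V x y" by simp
      also have "\<dots> \<le> 1 * 1" using Q Q0 V1 p by (intro mult_mono) auto
      finally have "P x * V x y * ln (V x y / Q) / ln 2 \<le> 1 / ln 2" by (intro divide_right_mono) auto
      then show ?thesis by (simp add: log_def Q_def mult.assoc)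
    qed auto
  qed
  then show ?thesis by simp
qed

text \<open>Where the centred log-likelihood ratio stays below \<open>n * \<delta>\<close>, the
  density with respect to the product law is at most \<open>2 powr (n * (r + \<delta>))\<close>;
  Chebyshev covers the remaining outputs. The constant \<open>v\<close> depends only on
  \<open>V\<close> and \<open>Q\<close>.\<close>

lemma change_of_measure_bound:
  fixes V :: "'x::finite \<Rightarrow> 'y::finite \<Rightarrow> real"
  assumes V: "is_channel V" and Q: "is_pmf Q" and ac: "\<And>x y. 0 < V x y \<Longrightarrow> 0 < Q y"
  shows "\<exists>v\<ge>0. \<forall>xs A (r :: real) (\<delta> :: real). xs \<noteq> [] \<longrightarrow> 0 < \<delta> \<longrightarrow>
           (\<Sum>x\<leftarrow>xs. divergence (V x) Q) \<le> length xs * r \<longrightarrow>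
           block_expect V xs (\<lambda>zs. if A zs then 1 else 0)
             \<le> 2 powr (length xs * (r + \<delta>)) * block_expect (\<lambda>_. Q) xs (\<lambda>zs. if A zs then 1 else 0)
               + v / (length xs * \<delta>\<^sup>2)"
proof -
  define l where "l = (\<lambda>x y. log 2 (V x y / Q y))"
  define h where "h = (\<lambda>x y. l x y - divergence (V x) Q)"
  define v where "v = (\<Sum>x\<in>UNIV. \<Sum>y\<in>UNIV. (h x y)\<^sup>2)"
  have pmf: "is_pmf (V x)" for x using V by (simp add: is_channel_def)
  have V0: "0 \<le> V x y" for x y using pmf[of x] by (simp add: is_pmf_def)
  have Q0: "0 \<le> Q y" for y using Q by (simp add: is_pmf_def)
  have h: "(h x y)\<^sup>2 \<le> v" for x y
  proof -
    have "(h x y)\<^sup>2 \<le> (\<Sum>y\<in>UNIV. (h x y)\<^sup>2)" by (intro member_le_sum) auto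
    also have "\<dots> \<le> v" unfolding v_def
      by (rule member_le_sum[of x UNIV "\<lambda>x. \<Sum>y\<in>UNIV. (h x y)\<^sup>2"]) (auto intro: sum_nonneg)
    finally show ?thesis .
  qed
  have mean: "(\<Sum>y\<in>UNIV. V x y * h x y) = 0" for x
    using pmf[of x] by (simp add: h_def right_diff_distrib sum_subtractf sum_distrib_right[symmetric]
        is_pmf_def divergence_def l_def)
  have v0: "0 \<le> v" unfolding v_def by (intro sum_nonneg) auto
  show ?thesis
  proof (intro exI[of _ v] conjI allI impI v0)
    fix xs :: "'x list" and A :: "'y list \<Rightarrow> bool" and r \<delta> :: real
    assume ne: "xs \<noteq> []" and \<delta>: "0 < \<delta>" and r: "(\<Sum>x\<leftarrow>xs. divergence (V x) Q) \<le> length xs * r"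
    define n where "n = real (length xs)"
    have n0: "0 < n" using ne by (simp add: n_def)
    let ?S = "block_sum h xs" and ?I = "\<lambda>zs. if A zs then 1 else 0 :: real"
    have "block_expect V xs (\<lambda>zs. (?S zs)\<^sup>2) = (\<Sum>x\<leftarrow>xs. \<Sum>y\<in>UNIV. V x y * (h x y)\<^sup>2)"
      by (rule centred_moments(2)[of xs V h v]) (use pmf mean h in auto)
    also have "\<dots> \<le> (\<Sum>x\<leftarrow>xs. v)"
    proof (rule sum_list_mono)
      fix x
      have "(\<Sum>y\<in>UNIV. V x y * (h x y)\<^sup>2) \<le> (\<Sum>y\<in>UNIV. V x y * v)"
        by (intro sum_mono mult_left_mono h V0)
      then show "(\<Sum>y\<in>UNIV. V x y * (h x y)\<^sup>2) \<le> v"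
        using pmf[of x] by (simp add: sum_distrib_right[symmetric] is_pmf_def)
    qed
    finally have var: "block_expect V xs (\<lambda>zs. (?S zs)\<^sup>2) \<le> n * v"
      by (simp add: sum_list_triv n_def)
    have "block_expect V xs ?I \<le> 2 powr (n * (r + \<delta>)) * block_expect (\<lambda>_. Q) xs ?I
        + block_expect V xs (\<lambda>zs. (1 / (n * \<delta>)\<^sup>2) * (?S zs)\<^sup>2)"
      unfolding block_expect_def sum_distrib_left sum.distrib[symmetric]
    proof (rule sum_mono)
      fix zs :: "'y list"
      define p where "p = (\<Prod>i<length xs. V (xs ! i) (zs ! i))"
      define p' where "p' = (\<Prod>i<length xs. Q (zs ! i))"
      have p0: "0 \<le> p" "0 \<le> p'" unfolding p_def p'_def by (auto intro: prod_nonneg V0 Q0)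
      show "p * ?I zs \<le> 2 powr (n * (r + \<delta>)) * (p' * ?I zs) + p * (1 / (n * \<delta>)\<^sup>2 * (?S zs)\<^sup>2)"
      proof (cases "p = 0 \<or> \<not> A zs")
        case True
        then show ?thesis using p0 by auto
      next
        case False
        then have A: "A zs" and pne: "p \<noteq> 0" by auto
        show ?thesis
        proof (cases "n * \<delta> \<le> ?S zs")
          case True
          have "(n * \<delta>)\<^sup>2 \<le> (?S zs)\<^sup>2" using True n0 \<delta> by (intro power_mono) auto
          then have "1 \<le> 1 / (n * \<delta>)\<^sup>2 * (?S zs)\<^sup>2" using n0 \<delta> by (simp add: le_divide_eq)
          then have "p * 1 \<le> p * (1 / (n * \<delta>)\<^sup>2 * (?S zs)\<^sup>2)" using p0 by (intro mult_left_mono) auto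
          moreover have "0 \<le> 2 powr (n * (r + \<delta>)) * (p' * ?I zs)" using p0 by simp
          ultimately show ?thesis using A by simp
        next
          case S: False
          have Vpos: "0 < V (xs ! i) (zs ! i)" if "i < length xs" for i
            using pne V0[of "xs ! i" "zs ! i"] that by (auto simp: p_def less_le)
          \<comment> \<open>Nonzero weight makes every factor \<open>V\<close> positive, hence also
            \<open>Q\<close> by \<open>ac\<close>, so each likelihood ratio is a genuine power of
            2.\<close>
          have "p = (\<Prod>i<length xs. 2 powr l (xs ! i) (zs ! i) * Q (zs ! i))"
            unfolding p_def
          proof (intro prod.cong refl)
            fix i assume "i \<in> {..<length xs}"
            then have "0 < V (xs ! i) (zs ! i)" using Vpos by simp
            then show "V (xs ! i) (zs ! i) = 2 powr l (xs ! i) (zs ! i) * Q (zs ! i)"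
              using ac[of "xs ! i" "zs ! i"] by (simp add: l_def)
          qed
          also have "\<dots> = 2 powr (\<Sum>i<length xs. l (xs ! i) (zs ! i)) * p'"
            by (simp add: prod.distrib p'_def powr_sum)
          also have "(\<Sum>i<length xs. l (xs ! i) (zs ! i)) = ?S zs + (\<Sum>x\<leftarrow>xs. divergence (V x) Q)"
            by (simp add: block_sum_def h_def sum_subtractf sum_list_sum_nth atLeast0LessThan)
          also have "2 powr (?S zs + (\<Sum>x\<leftarrow>xs. divergence (V x) Q)) * p' \<le> 2 powr (n * (r + \<delta>)) * p'"
            using S r p0 by (intro mult_right_mono) (auto simp: n_def distrib_left)
          finally show ?thesis using A p0 by (simp add: add_increasing2)
        qed
      qed
    qed
    also have "block_expect V xs (\<lambda>zs. (1 / (n * \<delta>)\<^sup>2) * (?S zs)\<^sup>2) \<le> (1 / (n * \<delta>)\<^sup>2) * (n * v)"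
      unfolding block_expect_cmult using var by (intro mult_left_mono) auto
    also have "(1 / (n * \<delta>)\<^sup>2) * (n * v) = v / (n * \<delta>\<^sup>2)"
      using n0 \<delta> by (simp add: power2_eq_square field_simps)
    finally show "block_expect V xs ?I \<le> 2 powr (length xs * (r + \<delta>)) * block_expect (\<lambda>_. Q) xs ?I
               + v / (length xs * \<delta>\<^sup>2)"
      by (simp add: n_def)
  qed
qed

section \<open>A finite family of fully supported input laws\<close>

text \<open>Round the composition down to multiples of \<open>1 / k\<close>, add one unit to every
  letter and normalise. The extra unit gives full support and undoes the rounding; normalisation
  costs a factor of at most \<open>1 + \<eta>\<close> once \<open>k\<close> exceeds
  \<open>CARD('x) / \<eta>\<close>.\<close>

lemma finite_dominating_pmfs:
  fixes \<eta> :: real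
  assumes "0 < \<eta>"
  shows "\<exists>F :: ('x::finite \<Rightarrow> real) set. finite F \<and> (\<forall>P\<in>F. is_pmf P \<and> (\<forall>x. 0 < P x)) \<and>
           (\<forall>xs. \<exists>P\<in>F. \<forall>x. count_list xs x \<le> (1 + \<eta>) * length xs * P x)"
proof -
  obtain k :: nat where k: "CARD('x) / \<eta> < k" using reals_Archimedean2 by blast
  have k0: "0 < k" using k assms by (metis divide_nonneg_pos not_less of_nat_0 of_nat_0_le_iff neq0_conv)
  define N where "N = (\<lambda>a :: 'x \<Rightarrow> nat. \<Sum>x\<in>UNIV. real (a x) + 1)"
  define G where "G = (\<lambda>(a :: 'x \<Rightarrow> nat) x. (real (a x) + 1) / N a)"
  define F where "F = G ` (UNIV \<rightarrow>\<^sub>E {..k})"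
  have N0: "0 < N a" for a unfolding N_def by (intro sum_pos) auto
  have "finite F" unfolding F_def by (intro finite_imageI finite_PiE) auto
  moreover have "is_pmf P \<and> (\<forall>x. 0 < P x)" if PF: "P \<in> F" for P
  proof -
    obtain a where "P = G a" using PF by (auto simp: F_def)
    moreover have "(\<Sum>x\<in>UNIV. G a x) = 1"
      using N0[of a] unfolding G_def sum_divide_distrib[symmetric] by (simp add: N_def)
    moreover have "0 < G a x" for x unfolding G_def using N0[of a] by (intro divide_pos_pos) auto
    ultimately show ?thesis by (auto simp: is_pmf_def less_imp_le)
  qed
  moreover have "\<exists>P\<in>F. \<forall>x. count_list xs x \<le> (1 + \<eta>) * length xs * P x" for xs :: "'x list"
  proof -
    define n where "n = length xs"
    define a where "a = (\<lambda>x. k * count_list xs x div n)"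
    have "k * count_list xs x \<le> k * n" for x by (simp add: n_def count_le_length)
    \<comment> \<open>For the empty word \<open>div\<close> by zero returns 0, so the bound
      persists.\<close>
    then have "a x \<le> k" for x
      unfolding a_def by (metis div_le_mono div_mult_self_is_m div_by_0 le0 neq0_conv)
    then have aF: "G a \<in> F" unfolding F_def by (intro imageI) auto
    have "real (count_list xs x) \<le> (1 + \<eta>) * n * G a x" for x
    proof (cases "n = 0")
      case False
      have up: "real (k * count_list xs x) \<le> n * (real (a x) + 1)" for x
      proof -
        have "k * count_list xs x \<le> n * (a x + 1)"
          unfolding a_def using False by (metis Suc_eq_plus1 dividend_less_times_div less_imp_le mult_Suc_right neq0_conv add.commute)
        then show ?thesis by (metis of_nat_1 of_nat_add of_nat_le_iff of_nat_mult)
      qed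
      have "real (a x) \<le> k * count_list xs x / n" for x
        unfolding a_def using of_nat_div_le_of_nat[of "k * count_list xs x" n, where ?'a = real] by simp
      then have "N a \<le> (\<Sum>x\<in>UNIV. real k * count_list xs x / n + 1)"
        unfolding N_def by (intro sum_mono add_mono) auto
      also have "\<dots> = k * (\<Sum>x\<in>UNIV. count_list xs x) / n + CARD('x)"
        by (simp add: sum.distrib sum_distrib_left sum_divide_distrib)
      also have "(\<Sum>x\<in>UNIV. count_list xs x) = n"
        unfolding n_def by (rule sum_count_set) auto
      also have "real (k * n) / n + CARD('x) \<le> k * (1 + \<eta>)"
        using k assms False by (simp add: field_simps)
      \<comment> \<open>The rounded counts add up to at most \<open>k\<close>, and the extra units
        to \<open>CARD('x)\<close>, which is below \<open>k * \<eta>\<close>.\<close>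
      finally have Nk: "N a \<le> k * (1 + \<eta>)" .
      have "k * real (count_list xs x) \<le> n * (N a * G a x)"
        using up[of x] N0[of a] by (simp add: G_def)
      also have "\<dots> \<le> n * (k * (1 + \<eta>) * G a x)"
        using Nk N0[of a] by (intro mult_left_mono mult_right_mono) (auto simp: G_def)
      finally have "k * real (count_list xs x) \<le> k * ((1 + \<eta>) * n * G a x)" by (simp add: mult_ac)
      then show ?thesis using k0 by simp
    qed (simp add: n_def)
    then show ?thesis using aF by (auto simp: n_def)
  qed
  ultimately show ?thesis by blast
qed

section \<open>The converse\<close>

lemma poly_times_exp_tendsto_0:
  fixes \<delta> :: real
  assumes "0 < \<delta>" "0 < k"
  shows "(\<lambda>n. real ((n + 1) ^ k) * 2 powr (- (n * \<delta>))) \<longlonglongrightarrow> 0"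
proof -
  \<comment> \<open>Taking the \<open>k\<close>-th root of the exponential gives each of the
    \<open>k\<close> factors \<open>n + 1\<close> its own geometric decay.\<close>
  define y where "y = (2 :: real) powr (- (\<delta> / k))"
  have y: "norm y < 1" using assms by (simp add: y_def powr_less_one)
  have "(\<lambda>n. (real n * y ^ n + y ^ n) ^ k) \<longlonglongrightarrow> (0 + 0) ^ k"
    using y by (intro tendsto_power tendsto_add powser_times_n_limit_0 LIMSEQ_power_zero)
  moreover have "(real n * y ^ n + y ^ n) ^ k = real ((n + 1) ^ k) * 2 powr (- (n * \<delta>))" for n
  proof -
    have "(y ^ n) ^ k = 2 powr (- (n * \<delta>))"
      using assms(2) by (simp add: y_def powr_power)
    then show ?thesis by (simp add: power_mult_distrib[symmetric] distrib_right add.commute flip: \<open>(y ^ n) ^ k = _\<close>)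
  qed
  ultimately show ?thesis using assms(2) by (simp add: zero_power)
qed

text \<open>The real-valued \<open>INF\<close> and \<open>SUP\<close> carry information only over
  nonempty bounded sets. Nonnegativity of mutual information bounds the infimum from below; the
  diagonal coupling gives nonemptiness and an upper bound uniform in \<open>P\<close>.\<close>

lemma Mmax_almost_optimal:
  fixes W :: "'x::finite \<Rightarrow> 'y::finite \<Rightarrow> real"
  assumes W: "is_channel W" and P: "is_pmf P" and r: "Rbar W q < r"
  shows "\<exists>V. V \<in> Mmax q P \<and> marg_Y V = W \<and> mutual_info P (marg_Yhat V) < r"
proof -
  define S where "S = (\<lambda>P. {V. V \<in> Mmax q P \<and> marg_Y V = W})"
  define f where "f = (\<lambda>P. INF V\<in>S P. mutual_info P (marg_Yhat V))"
  have ne: "\<exists>V\<in>S P. marg_Yhat V = W" for P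
    using diagonal_in_Mmax[OF W] unfolding S_def by blast
  have bdd: "bdd_below ((\<lambda>V. mutual_info P (marg_Yhat V)) ` S P)" if "is_pmf P" for P
    using mutual_info_nonneg[OF that is_channel_marg_Yhat]
    by (intro bdd_belowI[of _ 0]) (auto simp: S_def Mmax_def)
  have f_le: "f P \<le> CARD('x) * CARD('y) / ln 2" if "is_pmf P" for P
  proof -
    obtain V where V: "V \<in> S P" "marg_Yhat V = W" using ne by blast
    have "f P \<le> mutual_info P (marg_Yhat V)" unfolding f_def by (rule cINF_lower[OF bdd[OF that] V(1)])
    also have "\<dots> \<le> CARD('x) * CARD('y) / ln 2" unfolding V(2) by (rule mutual_info_le[OF that W])
    finally show ?thesis .
  qed
  have "f P \<le> (SUP P\<in>{P. is_pmf P}. f P)"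
    using P f_le by (intro cSUP_upper bdd_aboveI2) auto
  also have "\<dots> = Rbar W q" by (simp add: Rbar_def f_def S_def)
  finally have "(INF V\<in>S P. mutual_info P (marg_Yhat V)) < r" using r by (simp add: f_def)
  moreover have "S P \<noteq> {}" using ne by blast
  ultimately have "\<exists>V\<in>S P. mutual_info P (marg_Yhat V) < r"
    using cINF_less_iff[OF _ bdd[OF P]] by blast
  then show ?thesis by (auto simp: S_def)
qed

text \<open>Each divergence is nonnegative, so one-sided domination of the letter counts carries
  over to the weighted sum.\<close>

lemma divergence_sum_le:
  fixes P :: "'x::finite \<Rightarrow> real" and V :: "'x \<Rightarrow> 'y::finite \<Rightarrow> real" and \<eta> :: real
  assumes P: "is_pmf P" and V: "is_channel V" and pos: "\<And>x. 0 < P x"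
    and dom: "\<And>x. count_list xs x \<le> (1 + \<eta>) * length xs * P x"
  shows "(\<Sum>x\<leftarrow>xs. divergence (V x) (output_pmf P V)) \<le> length xs * ((1 + \<eta>) * mutual_info P V)"
proof -
  let ?D = "\<lambda>x. divergence (V x) (output_pmf P V)"
  have "(\<Sum>x\<leftarrow>xs. ?D x) = (\<Sum>x\<in>UNIV. real (count_list xs x) * ?D x)"
  proof (induction xs)
    case (Cons a xs)
    have "(\<Sum>x\<in>UNIV. real (count_list (a # xs) x) * ?D x)
        = (\<Sum>x\<in>UNIV. real (count_list xs x) * ?D x + (if x = a then ?D x else 0))"
      by (intro sum.cong) (auto simp: algebra_simps)
    with Cons show ?case by (simp add: sum.distrib)
  qed simp
  also have "\<dots> \<le> (\<Sum>x\<in>UNIV. (1 + \<eta>) * length xs * P x * ?D x)"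
    by (intro sum_mono mult_right_mono dom divergence_output_nonneg[OF P V pos])
  also have "\<dots> = length xs * ((1 + \<eta>) * mutual_info P V)"
    by (simp add: mutual_info_eq_divergence sum_distrib_left mult_ac)
  finally show ?thesis .
qed

text \<open>Under a product output law the distribution of \<open>zs\<close> does not depend on the
  codeword, so the sum moves inside one expectation, where \<open>card_isolated_le\<close> applies
  pointwise.\<close>

lemma sum_isolated_le:
  fixes C :: "'x::finite list list" and Q :: "'y::finite \<Rightarrow> real"
  assumes C: "is_codebook n C" and Q: "is_pmf Q"
  shows "(\<Sum>m<length C. block_expect (\<lambda>_. Q) (C ! m) (\<lambda>zs. if isolated C m zs then 1 else 0))
           \<le> (n + 1) ^ CARD('x \<times> 'y)"
proof -
  have len: "length c = n" if "c \<in> set C" for c using C that by (simp add: is_codebook_def)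
  \<comment> \<open>Any word of length \<open>n\<close> would do as the common block.\<close>
  define xs where "xs = hd C"
  have xs: "length xs = n" using C len by (simp add: xs_def is_codebook_def)
  have "(\<Sum>m<length C. block_expect (\<lambda>_. Q) (C ! m) (\<lambda>zs. if isolated C m zs then 1 else 0))
      = (\<Sum>m<length C. block_expect (\<lambda>_. Q) xs (\<lambda>zs. if isolated C m zs then 1 else 0))"
    by (intro sum.cong refl block_expect_cong) (simp_all add: len xs)
  also have "\<dots> = block_expect (\<lambda>_. Q) xs (\<lambda>zs. \<Sum>m<length C. if isolated C m zs then 1 else 0)"
    by (simp add: block_expect_sum)
  also have "\<dots> = block_expect (\<lambda>_. Q) xs (\<lambda>zs. real (card {m. m < length C \<and> isolated C m zs}))"
    by (intro block_expect_cong refl) (simp add: sum.If_cases Int_def)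
  also have "\<dots> \<le> block_expect (\<lambda>_. Q) xs (\<lambda>zs. real ((n + 1) ^ CARD('x \<times> 'y)))"
  proof (intro block_expect_mono Q)
    fix zs :: "'y list" assume "length zs = length xs"
    then have "card {m. m < length C \<and> isolated C m zs} \<le> (n + 1) ^ CARD('x \<times> 'y)"
      using card_isolated_le[of C zs] len xs by simp
    then show "real (card {m. m < length C \<and> isolated C m zs}) \<le> real ((n + 1) ^ CARD('x \<times> 'y))"
      by (rule of_nat_mono)
  qed
  also have "\<dots> = (n + 1) ^ CARD('x \<times> 'y)" by (rule block_expect_const) (rule Q)
  finally show ?thesis .
qed

text \<open>The margin \<open>4 * \<delta>\<close> is spent in four parts: near-optimality of
  \<open>V\<close>, domination of the composition, change of measure, and the decay that beats the
  polynomial number of types.\<close>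

lemma Pe_lower_bound:
  fixes W :: "'x::finite \<Rightarrow> 'y::finite \<Rightarrow> real"
  assumes W: "is_channel W" and \<delta>: "0 < \<delta>"
  shows "\<exists>c>0. \<exists>a\<ge>0. \<exists>v\<ge>0. \<forall>n C. 0 < n \<longrightarrow> is_codebook n C \<longrightarrow>
      2 powr (n * (Rbar W q + 4 * \<delta>)) \<le> length C \<longrightarrow>
      c * (1 - (a * (real ((n + 1) ^ CARD('x \<times> 'y)) * 2 powr (- (n * \<delta>))) + v / n)) \<le> Pe q W n C"
proof -
  define b where "b = real CARD('x) * CARD('y) / ln 2"
  have b: "0 < b" by (simp add: b_def)
  \<comment> \<open>Chosen so that \<open>\<eta>\<close> times any mutual information, at most
    \<open>b\<close>, costs at most \<open>\<delta>\<close>.\<close>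
  define \<eta> where "\<eta> = \<delta> / b"
  have \<eta>: "0 < \<eta>" using b \<delta> by (simp add: \<eta>_def)
  obtain F :: "('x \<Rightarrow> real) set" where F: "finite F" "\<And>P. P \<in> F \<Longrightarrow> is_pmf P"
      "\<And>P x. P \<in> F \<Longrightarrow> 0 < P x"
      and dom: "\<And>xs. \<exists>P\<in>F. \<forall>x. count_list xs x \<le> (1 + \<eta>) * length xs * P x"
    using finite_dominating_pmfs[OF \<eta>] by blast
  have "\<exists>V. V \<in> Mmax q P \<and> marg_Y V = W \<and> mutual_info P (marg_Yhat V) < Rbar W q + \<delta>" if "P \<in> F" for P
    using Mmax_almost_optimal[OF W F(2)[OF that]] \<delta> by simp
  then obtain V where V: "\<And>P. P \<in> F \<Longrightarrow> V P \<in> Mmax q P" "\<And>P. P \<in> F \<Longrightarrow> marg_Y (V P) = W"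
      "\<And>P. P \<in> F \<Longrightarrow> mutual_info P (marg_Yhat (V P)) < Rbar W q + \<delta>"
    by metis
  define H where "H = (\<lambda>P. marg_Yhat (V P))"
  define Q where "Q = (\<lambda>P. output_pmf P (H P))"
  have ch: "is_channel (H P)" if "P \<in> F" for P
    using V(1)[OF that] is_channel_marg_Yhat by (auto simp: H_def Mmax_def)
  have Q: "is_pmf (Q P)" if "P \<in> F" for P
    unfolding Q_def by (rule is_pmf_output_pmf[OF F(2)[OF that] ch[OF that]])
  let ?iso = "\<lambda>C m zs. if isolated C m zs then 1 else (0 :: real)"
  have "\<forall>P\<in>F. \<exists>c>0. \<forall>n C m. is_codebook n C \<longrightarrow> m < length C \<longrightarrow>
     c * (1 - block_expect (H P) (C ! m) (?iso C m))
     \<le> (\<Sum>ys | length ys = n. if \<exists>m'<length C. m' \<noteq> m \<and> qn q n (C ! m') ys \<ge> qn q n (C ! m) ys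
          then Wn W n (C ! m) ys else 0)"
  proof
    fix P assume PF: "P \<in> F"
    show "\<exists>c>0. \<forall>n C m. is_codebook n C \<longrightarrow> m < length C \<longrightarrow>
     c * (1 - block_expect (H P) (C ! m) (?iso C m))
     \<le> (\<Sum>ys | length ys = n. if \<exists>m'<length C. m' \<noteq> m \<and> qn q n (C ! m') ys \<ge> qn q n (C ! m) ys
          then Wn W n (C ! m) ys else 0)"
      using codeword_error_lower_bound[OF V(1)[OF PF] F(3)[OF PF]] unfolding H_def V(2)[OF PF] .
  qed
  then obtain cP where cP: "\<forall>P\<in>F. 0 < cP P \<and> (\<forall>n C m. is_codebook n C \<longrightarrow> m < length C \<longrightarrow>
     cP P * (1 - block_expect (H P) (C ! m) (?iso C m))
     \<le> (\<Sum>ys | length ys = n. if \<exists>m'<length C. m' \<noteq> m \<and> qn q n (C ! m') ys \<ge> qn q n (C ! m) ys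
          then Wn W n (C ! m) ys else 0))"
    by (subst (asm) bchoice_iff) (elim exE, rule that)
  \<comment> \<open>Finiteness of \<open>F\<close> turns the constants attached to each law into one
    positive constant.\<close>
  define c where "c = Min (insert 1 (cP ` F))"
  have c0: "0 < c" unfolding c_def using F(1) cP by (subst Min_gr_iff) auto
  have c_le: "c \<le> cP P" if "P \<in> F" for P unfolding c_def using F(1) that by (intro Min_le) auto
  have "\<forall>P\<in>F. \<exists>v\<ge>0. \<forall>xs A (r::real) (d::real). xs \<noteq> [] \<longrightarrow> 0 < d \<longrightarrow>
           (\<Sum>x\<leftarrow>xs. divergence (H P x) (Q P)) \<le> length xs * r \<longrightarrow>
           block_expect (H P) xs (\<lambda>zs. if A zs then 1 else 0)
             \<le> 2 powr (length xs * (r + d)) * block_expect (\<lambda>_. Q P) xs (\<lambda>zs. if A zs then 1 else 0)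
               + v / (length xs * d\<^sup>2)"
  proof
    fix P assume PF: "P \<in> F"
    have "0 < Q P y" if "0 < H P x y" for x y
      using output_pmf_ge[OF F(2)[OF PF] ch[OF PF], of x y] mult_pos_pos[OF F(3)[OF PF] that]
      unfolding Q_def by (rule less_le_trans[rotated])
    then show "\<exists>v\<ge>0. \<forall>xs A (r::real) (d::real). xs \<noteq> [] \<longrightarrow> 0 < d \<longrightarrow>
           (\<Sum>x\<leftarrow>xs. divergence (H P x) (Q P)) \<le> length xs * r \<longrightarrow>
           block_expect (H P) xs (\<lambda>zs. if A zs then 1 else 0)
             \<le> 2 powr (length xs * (r + d)) * block_expect (\<lambda>_. Q P) xs (\<lambda>zs. if A zs then 1 else 0)
               + v / (length xs * d\<^sup>2)"
      by (rule change_of_measure_bound[OF ch[OF PF] Q[OF PF]])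
  qed
  then obtain vP where vP: "\<forall>P\<in>F. 0 \<le> vP P \<and> (\<forall>xs A (r::real) (d::real). xs \<noteq> [] \<longrightarrow> 0 < d \<longrightarrow>
           (\<Sum>x\<leftarrow>xs. divergence (H P x) (Q P)) \<le> length xs * r \<longrightarrow>
           block_expect (H P) xs (\<lambda>zs. if A zs then 1 else 0)
             \<le> 2 powr (length xs * (r + d)) * block_expect (\<lambda>_. Q P) xs (\<lambda>zs. if A zs then 1 else 0)
               + vP P / (length xs * d\<^sup>2))"
    by (subst (asm) bchoice_iff) (elim exE, rule that)
  define v where "v = (\<Sum>P\<in>F. vP P) / \<delta>\<^sup>2"
  have v0: "0 \<le> v" unfolding v_def using vP by (intro divide_nonneg_nonneg sum_nonneg) auto
  define r where "r = Rbar W q + 2 * \<delta>"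
  show ?thesis
  proof (rule exI[of _ c], intro conjI c0, rule exI[of _ "real (card F)"], intro conjI of_nat_0_le_iff,
      rule exI[of _ v], intro conjI v0 allI impI)
    fix n and C :: "'x list list"
    assume n: "0 < n" and C: "is_codebook n C" and M: "2 powr (n * (Rbar W q + 4 * \<delta>)) \<le> length C"
    define M where "M = real (length C)"
    define k where "k = CARD('x \<times> 'y)"
    have M0: "0 < M" using C by (simp add: M_def is_codebook_def)
    have len: "length (C ! m) = n" if "m < length C" for m using C that by (simp add: is_codebook_def)
    define err where "err = (\<lambda>m. \<Sum>ys | length ys = n.
        if \<exists>m'<length C. m' \<noteq> m \<and> qn q n (C ! m') ys \<ge> qn q n (C ! m) ys
          then Wn W n (C ! m) ys else 0)"
    define iQ where "iQ = (\<lambda>P m. block_expect (\<lambda>_. Q P) (C ! m) (?iso C m))"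
    have iQ0: "0 \<le> iQ P m" if "P \<in> F" for P m
    proof -
      have "block_expect (\<lambda>_. Q P) (C ! m) (\<lambda>_. 0) \<le> iQ P m"
        unfolding iQ_def by (rule block_expect_mono[OF Q[OF that]]) auto
      then show ?thesis by (simp add: block_expect_const[OF Q[OF that]])
    qed
    have err: "c * (1 - (2 powr (n * (r + \<delta>)) * (\<Sum>P\<in>F. iQ P m) + v / n)) \<le> err m"
      if m: "m < length C" for m
    proof -
      obtain P where PF: "P \<in> F" and P: "\<And>x. count_list (C ! m) x \<le> (1 + \<eta>) * length (C ! m) * P x"
        using dom by blast
      have I: "mutual_info P (H P) < Rbar W q + \<delta>" "mutual_info P (H P) \<le> b"
        using V(3)[OF PF] mutual_info_le[OF F(2)[OF PF] ch[OF PF]] by (auto simp: H_def b_def)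
      have "\<eta> * mutual_info P (H P) \<le> \<eta> * b" using I(2) \<eta> by (intro mult_left_mono) auto
      then have "(1 + \<eta>) * mutual_info P (H P) \<le> r"
        using I(1) b by (simp add: distrib_right \<eta>_def r_def)
      then have "n * ((1 + \<eta>) * mutual_info P (H P)) \<le> n * r" by (intro mult_left_mono) auto
      with divergence_sum_le[OF F(2)[OF PF] ch[OF PF] F(3)[OF PF] P]
      have D: "(\<Sum>x\<leftarrow>C ! m. divergence (H P x) (Q P)) \<le> length (C ! m) * r"
        unfolding Q_def len[OF m] by linarith
      have "block_expect (H P) (C ! m) (?iso C m) \<le> 2 powr (n * (r + \<delta>)) * iQ P m + vP P / (n * \<delta>\<^sup>2)"
        using vP[rule_format, OF PF, THEN conjunct2, rule_format, of "C ! m" \<delta> r "isolated C m", OF _ \<delta> D] n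
        unfolding iQ_def len[OF m] using len[OF m] by auto
      \<comment> \<open>The law \<open>P\<close> was chosen for this codeword; summing over
        \<open>F\<close> gives a bound of the same form for all messages.\<close>
      also have "\<dots> \<le> 2 powr (n * (r + \<delta>)) * (\<Sum>P\<in>F. iQ P m) + v / n"
      proof (intro add_mono mult_left_mono)
        show "iQ P m \<le> (\<Sum>P\<in>F. iQ P m)" using PF iQ0 F(1) by (intro member_le_sum[of P F "\<lambda>P. iQ P m"]) auto
        have "vP P \<le> (\<Sum>P\<in>F. vP P)" using PF vP F(1) by (intro member_le_sum) auto
        then have "vP P / (n * \<delta>\<^sup>2) \<le> (\<Sum>P\<in>F. vP P) / (n * \<delta>\<^sup>2)" by (intro divide_right_mono) auto
        then show "vP P / (n * \<delta>\<^sup>2) \<le> v / n" by (simp add: v_def mult.commute)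
      qed simp
      finally have bad: "block_expect (H P) (C ! m) (?iso C m)
        \<le> 2 powr (n * (r + \<delta>)) * (\<Sum>P\<in>F. iQ P m) + v / n" .
      \<comment> \<open>The factor \<open>1 - ...\<close> must be nonnegative before
        \<open>c\<close> may be replaced by the larger \<open>cP P\<close>.\<close>
      have "block_expect (H P) (C ! m) (?iso C m) \<le> block_expect (H P) (C ! m) (\<lambda>_. 1)"
        using ch[OF PF] by (intro block_expect_mono) (auto simp: is_channel_def)
      also have "\<dots> = 1" using ch[OF PF] by (intro block_expect_const) (auto simp: is_channel_def)
      finally have bad1: "block_expect (H P) (C ! m) (?iso C m) \<le> 1" .
      have "c * (1 - (2 powr (n * (r + \<delta>)) * (\<Sum>P\<in>F. iQ P m) + v / n))
          \<le> c * (1 - block_expect (H P) (C ! m) (?iso C m))"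
        using bad c0 by (intro mult_left_mono) auto
      also have "\<dots> \<le> cP P * (1 - block_expect (H P) (C ! m) (?iso C m))"
        using bad1 c_le[OF PF] by (intro mult_right_mono) auto
      also have "\<dots> \<le> err m" unfolding err_def using cP PF C m by blast
      finally show ?thesis .
    qed
    have "(\<Sum>m<length C. \<Sum>P\<in>F. iQ P m) = (\<Sum>P\<in>F. \<Sum>m<length C. iQ P m)" by (rule sum.swap)
    also have "\<dots> \<le> (\<Sum>P\<in>F. real ((n + 1) ^ k))"
      unfolding iQ_def k_def by (intro sum_mono sum_isolated_le[OF C] Q)
    finally have iso: "(\<Sum>m<length C. \<Sum>P\<in>F. iQ P m) \<le> card F * real ((n + 1) ^ k)" by simp
    \<comment> \<open>Here \<open>r + \<delta>\<close> is \<open>Rbar W q + 3 * \<delta>\<close>,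
      which lies \<open>\<delta>\<close> below the assumed rate.\<close>
    have "2 powr (n * (r + \<delta>)) = 2 powr (n * (Rbar W q + 4 * \<delta>)) * 2 powr (- (n * \<delta>))"
      by (simp add: powr_add[symmetric] r_def algebra_simps)
    also have "\<dots> \<le> M * 2 powr (- (n * \<delta>))" using M by (intro mult_right_mono) (auto simp: M_def)
    finally have "2 powr (n * (r + \<delta>)) * (\<Sum>m<length C. \<Sum>P\<in>F. iQ P m)
        \<le> (M * 2 powr (- (n * \<delta>))) * (card F * real ((n + 1) ^ k))"
      using iso iQ0 M0 by (intro mult_mono) (auto intro!: sum_nonneg)
    then have "c * (M * (1 - (card F * (real ((n + 1) ^ k) * 2 powr (- (n * \<delta>))) + v / n)))
        \<le> c * (M - 2 powr (n * (r + \<delta>)) * (\<Sum>m<length C. \<Sum>P\<in>F. iQ P m) - M * (v / n))"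
      using c0 by (intro mult_left_mono) (auto simp: algebra_simps)
    also have "\<dots> = (\<Sum>m<length C. c * (1 - (2 powr (n * (r + \<delta>)) * (\<Sum>P\<in>F. iQ P m) + v / n)))"
      by (simp only: sum_distrib_left[symmetric] sum_subtractf sum.distrib sum_constant card_lessThan M_def)
        (simp add: algebra_simps)
    also have "\<dots> \<le> (\<Sum>m<length C. err m)" by (intro sum_mono err) simp
    also have "\<dots> = M * Pe q W n C" using M0 by (simp add: Pe_def M_def err_def)
    finally have "M * (c * (1 - (card F * (real ((n + 1) ^ k) * 2 powr (- (n * \<delta>))) + v / n)))
        \<le> M * Pe q W n C" by (simp add: mult_ac)
    then show "c * (1 - (card F * (real ((n + 1) ^ CARD('x \<times> 'y)) * 2 powr (- (n * \<delta>))) + v / n))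
        \<le> Pe q W n C"
      using M0 by (simp add: k_def)
  qed
qed

text \<open>Above \<open>Rbar W q\<close> the error probability is eventually at least
  \<open>c / 2\<close>, which excludes a zero limit even along a subsequence.\<close>

lemma achievable_le_Rbar:
  fixes W :: "'x::finite \<Rightarrow> 'y::finite \<Rightarrow> real"
  assumes W: "is_channel W" and R: "achievable q W R"
  shows "R \<le> Rbar W q"
proof (rule ccontr)
  assume "\<not> R \<le> Rbar W q"
  \<comment> \<open>One fifth of the gap is the rate loss allowed by achievability; the other four
    are the margin of \<open>Pe_lower_bound\<close>.\<close>
  define \<delta> where "\<delta> = (R - Rbar W q) / 5"
  have \<delta>: "0 < \<delta>" "R - \<delta> = Rbar W q + 4 * \<delta>"
    using \<open>\<not> R \<le> Rbar W q\<close> by (auto simp: \<delta>_def field_simps)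
  obtain Cs where Cs: "\<And>n. is_codebook n (Cs n)"
      "\<And>n. 2 powr (n * (R - \<delta>)) \<le> length (Cs n)"
      and lim: "liminf (\<lambda>n. ereal (Pe q W n (Cs n))) = 0"
    using R \<delta>(1) unfolding achievable_def by blast
  define k where "k = CARD('x \<times> 'y)"
  obtain c a v where c: "0 < c" and bound: "\<And>n C. 0 < n \<Longrightarrow> is_codebook n C \<Longrightarrow>
      2 powr (n * (Rbar W q + 4 * \<delta>)) \<le> length C \<Longrightarrow>
      c * (1 - (a * (real ((n + 1) ^ k) * 2 powr (- (n * \<delta>))) + v / n)) \<le> Pe q W n C"
    using Pe_lower_bound[OF W \<delta>(1), of q] unfolding k_def by blast
  have "(\<lambda>n. c * (1 - (a * (real ((n + 1) ^ k) * 2 powr (- (n * \<delta>))) + v / n))) \<longlonglongrightarrow> c * (1 - (a * 0 + 0))"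
    by (intro tendsto_intros poly_times_exp_tendsto_0 \<delta> lim_const_over_n) (simp add: k_def)
  then have "\<forall>\<^sub>F n in sequentially.
      c / 2 < c * (1 - (a * (real ((n + 1) ^ k) * 2 powr (- (n * \<delta>))) + v / n))"
    using c by (intro order_tendstoD) auto
  then have "\<forall>\<^sub>F n in sequentially. ereal (c / 2) \<le> ereal (Pe q W n (Cs n))"
    using eventually_gt_at_top[of 0]
  proof eventually_elim
    case (elim n)
    have "c * (1 - (a * (real ((n + 1) ^ k) * 2 powr (- (n * \<delta>))) + v / n)) \<le> Pe q W n (Cs n)"
      using elim(2) Cs[of n] \<delta>(2) by (intro bound) auto
    with elim(1) have "c / 2 \<le> Pe q W n (Cs n)" by linarith
    then show ?case by simp
  qed
  then have "ereal (c / 2) \<le> liminf (\<lambda>n. ereal (Pe q W n (Cs n)))" by (rule Liminf_bounded)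
  then show False using lim c by simp
qed

theorem theorem1:
  fixes W :: "'x::finite \<Rightarrow> 'y::finite \<Rightarrow> real"
    and q :: "'x \<Rightarrow> 'y \<Rightarrow> real"
  assumes "is_channel W"
  shows "mismatch_capacity q W \<le> ereal (Rbar W q)"
  unfolding mismatch_capacity_def
  by (rule Sup_least) (auto dest: achievable_le_Rbar[OF assms])

end
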